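(* Let $A$ be an $n$-qubit space and $\delta\in\mathbb R$. For a $\delta$-almost universal$_2$ linear random hash function $F:\{0,1\}^n\to\{0,1\}^m$ and for a sub-normalized state $\rho_{Z^AE}=\sum_z|z\rangle\langle z|_A\otimes\rho^z_E$, $${\rm E}_F\,Q^{{\rm PA},F}(\rho_{Z^AE})\le(\delta-1)\,{\rm Tr}(\rho)+2^{m-H_{\rm min}(Z^A|E)_\rho}.$$
   Context: All Hilbert spaces are finite-dimensional; logarithms are base 2 (with $2^{-\infty}=0$). A sub-normalized state is a positive semidefinite operator of trace at most 1; $\{|z\rangle\}_{z\in\{0,1\}^n}$ is the computational basis of $A=(\mathbb C^2)^{\otimes n}$. A linear random function $F:\{0,1\}^n\to\{0,1\}^m$ is a random variable with values in a finite set of $\mathbb F_2$-linear functions, and ${\rm E}_F\,r(F)=\sum_f\Pr[F=f]\,r(f)$. It is $\delta$-almost universal$_2$ if $\Pr[F(x)=0]\le2^{-m}\delta$ for all $x\ne0$. For linear $f:\{0,1\}^n\to\{0,1\}^m$, $\rho^f_{KE}=\sum_{k\in\{0,1\}^m}|k\rangle\langle k|_K\otimes\sum_{z\in f^{-1}(k)}\rho^z_E$. $H_{\rm max}(K|E)_\rho=\max_{\sigma_E\ge0,{\rm Tr}\sigma=1}\log\big(2^m\,\|\sqrt{\rho_{KE}}\sqrt{2^{-m}I_K\otimes\sigma_E}\|_1^2\big)$, and the privacy amplification index is $Q^{{\rm PA},f}(\rho_{Z^AE})={\rm Tr}(\rho_{Z^AE})-2^{H_{\rm max}(K|E)_{\rho^f}-m}$.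 $H_{\rm min}(Z^A|E)_\rho=-\log\min\{{\rm Tr}(\sigma):\sigma_E\ge0,\ \rho_{Z^AE}\le I_A\otimes\sigma_E\}$. *)

theory Defs
  imports
    "HOL-Probability.Probability_Mass_Function"
    "HOL-Library.Z2"
    "HOL-Library.Extended_Real"
    "Jordan_Normal_Form.Schur_Decomposition"
begin

unbundle no vec_syntax
unbundle no inner_syntax

section \<open>Operators on finite-dimensional Hilbert spaces\<close>

text \<open>
  Operators on a \<open>d\<close>-dimensional space are \<open>d \<times> d\<close> complex matrices. The order on \<^typ>\<open>complex\<close>
  is the one with \<open>0 \<le> c\<close> iff \<open>c\<close> is real and non-negative, so hermiticity is implied below.
\<close>

definition psd :: "nat \<Rightarrow> complex mat \<Rightarrow> bool" where
  "psd d A \<longleftrightarrow> A \<in> carrier_mat d d \<and> (\<forall>v \<in> carrier_vec d. 0 \<le> (A *\<^sub>v v) \<bullet>c v)"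

text \<open>The order on \<open>mat\<close> in the library is entrywise, hence a separate constant.\<close>

definition loewner_le :: "nat \<Rightarrow> complex mat \<Rightarrow> complex mat \<Rightarrow> bool" where
  "loewner_le d A B \<longleftrightarrow> psd d (B - A)"

definition mat_trace :: "complex mat \<Rightarrow> complex" where
  "mat_trace A = (\<Sum>i<dim_row A. A $$ (i, i))"

definition psd_sqrt :: "complex mat \<Rightarrow> complex mat" where
  "psd_sqrt A = (THE B. psd (dim_row A) B \<and> B * B = A)"

definition trace_norm :: "complex mat \<Rightarrow> real" where
  "trace_norm M = Re (mat_trace (psd_sqrt (mat_adjoint M * M)))"

definition normalized_state :: "nat \<Rightarrow> complex mat \<Rightarrow> bool" where
  "normalized_state d \<sigma> \<longleftrightarrow> psd d \<sigma> \<and> mat_trace \<sigma> = 1"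

definition subnormalized_state :: "nat \<Rightarrow> complex mat \<Rightarrow> bool" where
  "subnormalized_state d \<rho> \<longleftrightarrow> psd d \<rho> \<and> Re (mat_trace \<rho>) \<le> 1"

definition kron :: "complex mat \<Rightarrow> complex mat \<Rightarrow> complex mat" where
  "kron A B = mat (dim_row A * dim_row B) (dim_col A * dim_col B)
     (\<lambda>(i, j). A $$ (i div dim_row B, j div dim_col B) * B $$ (i mod dim_row B, j mod dim_col B))"

definition mat_sum :: "nat \<Rightarrow> ('a \<Rightarrow> complex mat) \<Rightarrow> 'a set \<Rightarrow> complex mat" where
  "mat_sum d X S = mat d d (\<lambda>(i, j). \<Sum>z\<in>S. X z $$ (i, j))"

definition ket_bra :: "complex vec \<Rightarrow> complex mat" where
  "ket_bra v = mat (dim_vec v) (dim_vec v) (\<lambda>(i, j). v $ i * conjugate (v $ j))"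


section \<open>Bit strings and classical-quantum operators\<close>

text \<open>
  Bit strings of length \<open>n\<close> are the elements of \<open>carrier_vec n :: bit vec set\<close>. With the first
  bit most significant, \<open>unit_vec (2 ^ n) (bits_index z)\<close> is the tensor product
  (in the sense of \<open>kron\<close>) of the single-qubit kets \<open>z $ 0\<close>, ..., \<open>z $ (n - 1)\<close>.
\<close>

definition bits_index :: "bit vec \<Rightarrow> nat" where
  "bits_index z = (\<Sum>i<dim_vec z. if z $ i = 1 then 2 ^ (dim_vec z - 1 - i) else 0)"

definition comp_ket :: "bit vec \<Rightarrow> complex vec" where
  "comp_ket z = unit_vec (2 ^ dim_vec z) (bits_index z)"

definition cq_op :: "nat \<Rightarrow> nat \<Rightarrow> (bit vec \<Rightarrow> complex mat) \<Rightarrow> complex mat" where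
  "cq_op n d \<rho> = mat_sum (2 ^ n * d) (\<lambda>z. kron (ket_bra (comp_ket z)) (\<rho> z)) (carrier_vec n)"

definition hashed :: "nat \<Rightarrow> nat \<Rightarrow> (bit vec \<Rightarrow> bit vec) \<Rightarrow> (bit vec \<Rightarrow> complex mat)
    \<Rightarrow> bit vec \<Rightarrow> complex mat" where
  "hashed n d f \<rho> k = mat_sum d \<rho> {z \<in> carrier_vec n. f z = k}"


section \<open>Linear random functions\<close>

definition f2_linear :: "nat \<Rightarrow> nat \<Rightarrow> (bit vec \<Rightarrow> bit vec) \<Rightarrow> bool" where
  "f2_linear n m f \<longleftrightarrow>
     (\<forall>x \<in> carrier_vec n. f x \<in> carrier_vec m) \<and>
     (\<forall>x \<in> carrier_vec n. \<forall>y \<in> carrier_vec n. f (x + y) = f x + f y) \<and>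
     (\<forall>c. \<forall>x \<in> carrier_vec n. f (c \<cdot>\<^sub>v x) = c \<cdot>\<^sub>v f x)"

definition linear_random_function :: "nat \<Rightarrow> nat \<Rightarrow> (bit vec \<Rightarrow> bit vec) pmf \<Rightarrow> bool" where
  "linear_random_function n m F \<longleftrightarrow> finite (set_pmf F) \<and> (\<forall>f \<in> set_pmf F. f2_linear n m f)"

definition almost_universal2 :: "nat \<Rightarrow> nat \<Rightarrow> real \<Rightarrow> (bit vec \<Rightarrow> bit vec) pmf \<Rightarrow> bool" where
  "almost_universal2 n m \<delta> F \<longleftrightarrow>
     (\<forall>x \<in> carrier_vec n. x \<noteq> 0\<^sub>v n \<longrightarrow>
        measure_pmf.prob F {f. f x = 0\<^sub>v m} \<le> 2 powr (- real m) * \<delta>)"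


section \<open>Entropies and the privacy amplification index\<close>

definition log2 :: "real \<Rightarrow> ereal" where
  "log2 x = (if x \<le> 0 then - \<infinity> else ereal (log 2 x))"

text \<open>The value at \<open>\<infinity>\<close> is a dummy: the exponents below are always smaller than \<open>\<infinity>\<close>.\<close>

definition exp2 :: "ereal \<Rightarrow> real" where
  "exp2 x = (if \<bar>x\<bar> = \<infinity> then 0 else 2 powr real_of_ereal x)"

text \<open>
  The supremum and the infimum below are attained: the set of normalized states is compact (and
  non-empty for \<open>d > 0\<close>; for \<open>d = 0\<close> the supremum is \<open>- \<infinity>\<close>), and so
  is the set of feasible \<open>\<sigma>\<close> of bounded trace. The operator \<open>\<rho>\<close> acts on \<open>m\<close> (respectively \<open>n\<close>)
  qubits tensored with a \<open>d\<close>-dimensional space.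
\<close>

definition H_max :: "nat \<Rightarrow> nat \<Rightarrow> complex mat \<Rightarrow> ereal" where
  "H_max m d \<rho> = (SUP \<sigma> \<in> {\<sigma>. normalized_state d \<sigma>}.
     log2 (2 ^ m *
       (trace_norm (psd_sqrt \<rho> *
          psd_sqrt (kron (complex_of_real (2 powr (- real m)) \<cdot>\<^sub>m 1\<^sub>m (2 ^ m)) \<sigma>)))\<^sup>2))"

definition H_min :: "nat \<Rightarrow> nat \<Rightarrow> complex mat \<Rightarrow> ereal" where
  "H_min n d \<rho> =
     - log2 (INF \<sigma> \<in> {\<sigma>. psd d \<sigma> \<and> loewner_le (2 ^ n * d) \<rho> (kron (1\<^sub>m (2 ^ n)) \<sigma>)}.
         Re (mat_trace \<sigma>))"

definition Q_PA :: "nat \<Rightarrow> nat \<Rightarrow> nat \<Rightarrow> (bit vec \<Rightarrow> bit vec) \<Rightarrow> (bit vec \<Rightarrow> complex mat) \<Rightarrow> real" where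
  "Q_PA n m d f \<rho> = Re (mat_trace (cq_op n d \<rho>))
     - exp2 (H_max m d (cq_op m d (hashed n d f \<rho>)) - ereal (real m))"

end

(*
  Fix sigma with rho^z <= sigma for all z, write t = Tr rho, rho_E for the sum of the rho^z, and put
  B = rho_E + eps I, b = Tr B. Testing the maximum in H_max at B / b bounds 2^(H_max - m) below by
  the squared fidelity F^2 of rho^f_KE and 2^(-m) I (x) B / b. In terms of the collision quantity
  X_f = 2^m sum_k Tr(rho_k B^(-1/2) rho_k B^(-1/2)), where rho_k is the k-th block of rho^f_KE,
  the comparison of the sandwiched Renyi divergences of orders 1/2 and 2 reads t^3 <= F^2 b X_f,
  so F^2 >= (t / b) (2 t - X_f).
  Splitting X_f into pairs (z, z'), the pairs z = z' contribute at most 2^m Tr sigma because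
  rho^z <= sigma and B^(-1/2) rho_E B^(-1/2) <= I, and almost universality bounds the expected
  contribution of the others by delta t. Let eps tend to 0 and minimise over sigma.
*)
theory Submission
  imports Defs
begin

section \<open>The spectral theorem\<close>

text \<open>The test operator B / b involves only the E part of the state, which hashing leaves
  alone. Hence one matrix B^(-1/2) serves every f: all X_f are sums of the same nonnegative numbers
  Tr(rho^z B^(-1/2) rho^w B^(-1/2)), and the hash function enters only through the events f z = f w.
  The lower bound t^3 / (b X_f) on the squared fidelity is not linear in X_f. Its convex factor t^2
  / X_f lies above its tangent 2 t - X_f at X_f = t, and expectations pass through the tangent. This
  loses nothing in the final form, since b tends to t and t - (2 t - X_f) = X_f - t. The shift by
  eps is there because rho_E may be singular: B is invertible in any case and still dominates rho_E.
  The comparison of the orders 1/2 and 2 concerns operators that need not commute. In the eigenbasis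
  of a single positive matrix it becomes an inequality between real sums, and repeated
  Cauchy-Schwarz suffices.\<close>

lemma square_mult_carrier[simp]:
  "A \<in> carrier_mat n n \<Longrightarrow> B \<in> carrier_mat n n \<Longrightarrow> A * B \<in> carrier_mat n n"
  by (rule mult_carrier_mat)

lemma square_one_mult[simp]:
  fixes A :: "complex mat"
  assumes "A \<in> carrier_mat n n"
  shows "1\<^sub>m n * A = A" "A * 1\<^sub>m n = A"
  using assms by (rule left_mult_one_mat, rule right_mult_one_mat)

lemma mat_adjoint_carrier[simp]: "A \<in> carrier_mat r c \<Longrightarrow> mat_adjoint A \<in> carrier_mat c r"
  by (auto simp: mat_adjoint_def mat_of_rows_def)

lemma mat_adjoint_dim[simp]: "dim_row (mat_adjoint A) = dim_col A" "dim_col (mat_adjoint A) = dim_row A"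
  by (auto simp: mat_adjoint_def mat_of_rows_def)

lemma mat_adjoint_index:
  "i < dim_col A \<Longrightarrow> j < dim_row A \<Longrightarrow> mat_adjoint A $$ (i, j) = conjugate (A $$ (j, i))"
  by (simp add: mat_adjoint_def mat_of_rows_def)

lemma mat_adjoint_adjoint[simp]: "mat_adjoint (mat_adjoint A) = A"
  by (rule eq_matI) (simp_all add: mat_adjoint_index)

lemma mat_adjoint_mult:
  fixes A B :: "complex mat"
  assumes "A \<in> carrier_mat r k" "B \<in> carrier_mat k c"
  shows "mat_adjoint (A * B) = mat_adjoint B * mat_adjoint A"
  using assms by (intro eq_matI) (auto simp: mat_adjoint_index scalar_prod_def sum_conjugate
      conjugate_dist_mul mult.commute intro!: sum.cong)

lemma mat_adjoint_one[simp]: "mat_adjoint (1\<^sub>m n :: complex mat) = 1\<^sub>m n"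
  by (rule eq_matI) (simp_all add: mat_adjoint_index)

lemma mat_adjoint_mult_vec:
  fixes X :: "complex mat"
  assumes "X \<in> carrier_mat r c" "w \<in> carrier_vec r" "v \<in> carrier_vec c"
  shows "(mat_adjoint X *\<^sub>v w) \<bullet>c v = w \<bullet>c (X *\<^sub>v v)"
proof -
  have "(mat_adjoint X *\<^sub>v w) \<bullet>c v = (\<Sum>i<c. \<Sum>j<r. cnj (X $$ (j, i)) * w $ j * cnj (v $ i))"
    using assms by (auto simp: scalar_prod_def mat_adjoint_index sum_distrib_right atLeast0LessThan intro!: sum.cong)
  also have "\<dots> = (\<Sum>j<r. \<Sum>i<c. cnj (X $$ (j, i)) * w $ j * cnj (v $ i))"
    by (rule sum.swap)
  also have "\<dots> = w \<bullet>c (X *\<^sub>v v)"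
    using assms by (auto simp: scalar_prod_def sum_distrib_left atLeast0LessThan ac_simps intro!: sum.cong)
  finally show ?thesis .
qed

definition hermitian :: "nat \<Rightarrow> complex mat \<Rightarrow> bool" where
  "hermitian n A \<longleftrightarrow> A \<in> carrier_mat n n \<and> mat_adjoint A = A"

definition unitary :: "nat \<Rightarrow> complex mat \<Rightarrow> bool" where
  "unitary n U \<longleftrightarrow> U \<in> carrier_mat n n \<and> mat_adjoint U * U = 1\<^sub>m n \<and> U * mat_adjoint U = 1\<^sub>m n"

text \<open>The eigenvalues are real by type, so roots, inverses and shifts of a matrix become
  operations on real functions.\<close>

definition dmat :: "nat \<Rightarrow> (nat \<Rightarrow> real) \<Rightarrow> complex mat" where
  "dmat n l = mat n n (\<lambda>(i, j). if i = j then complex_of_real (l i) else 0)"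

lemma unitaryI:
  assumes "U \<in> carrier_mat n n" "mat_adjoint U * U = 1\<^sub>m n"
  shows "unitary n U"
  using assms mat_mult_left_right_inverse[OF mat_adjoint_carrier[OF assms(1)] assms(1)]
  by (simp add: unitary_def)

lemma unitary_mult:
  assumes "unitary n U" "unitary n V" shows "unitary n (U * V)"
proof (rule unitaryI)
  have c: "U \<in> carrier_mat n n" "V \<in> carrier_mat n n" using assms by (auto simp: unitary_def)
  then show "U * V \<in> carrier_mat n n" by simp
  have "mat_adjoint (U * V) * (U * V) = mat_adjoint V * (mat_adjoint U * U) * V"
    using c mat_adjoint_carrier[OF c(1)] mat_adjoint_carrier[OF c(2)]
    by (simp add: mat_adjoint_mult[OF c] assoc_mult_mat[of _ n n _ n _ n] del: mat_adjoint_carrier)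
  then show "mat_adjoint (U * V) * (U * V) = 1\<^sub>m n"
    using assms c by (simp add: unitary_def)
qed

text \<open>Gram-Schmidt on a basis completed from \<open>v\<close> keeps \<open>v\<close> in front.
  Its output is orthogonal but not normalised, hence the rescaling \<open>c\<close> of the
  columns.\<close>

lemma unitary_with_first_column:
  fixes v :: "complex vec"
  assumes v: "v \<in> carrier_vec n" and v0: "v \<noteq> 0\<^sub>v n"
  obtains W c where "unitary n W" "col W 0 = c \<cdot>\<^sub>v v"
proof -
  interpret cof_vec_space n "TYPE(complex)" .
  define ws where "ws = gram_schmidt n (basis_completion v)"
  note bc = basis_completion[OF v v0]
  note gs = gram_schmidt_result[OF bc(2,4,5) refl, folded ws_def]
  have n: "n > 0" using v v0 by (cases n) auto
  have len: "length ws = n" using gs bc by simp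
  have hd: "hd ws = v"
    unfolding ws_def using bc(2,6,7) n v by (cases "basis_completion v") (auto intro!: gram_schmidt_hd)
  define c where "c w = complex_of_real (1 / sqrt (Re (w \<bullet>c w)))" for w :: "complex vec"
  have cc: "cnj (c w) = c w" for w by (simp add: c_def)
  define W where "W = mat_of_cols n (map (\<lambda>w. c w \<cdot>\<^sub>v w) ws)"
  have W: "W \<in> carrier_mat n n" by (simp add: W_def len mat_of_cols_def)
  have wsc: "ws ! i \<in> carrier_vec n" if "i < n" for i using gs(3) len that by (auto simp: subset_code)
  have colW: "col W i = c (ws ! i) \<cdot>\<^sub>v ws ! i" if "i < n" for i
    using that wsc[OF that] by (simp add: W_def len)
  have orth: "ws ! i \<bullet>c ws ! j = 0 \<longleftrightarrow> i \<noteq> j" if "i < n" "j < n" for i j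
    using gs that len by (auto simp: corthogonal_def)
  have "mat_adjoint W * W = 1\<^sub>m n"
  proof (rule eq_matI)
    fix i j assume "i < dim_row (1\<^sub>m n :: complex mat)" "j < dim_col (1\<^sub>m n :: complex mat)"
    then have ij: "i < n" "j < n" by auto
    have "(mat_adjoint W * W) $$ (i, j) = (\<Sum>k<n. cnj (col W i $ k) * col W j $ k)"
      using ij W by (auto simp: scalar_prod_def mat_adjoint_index atLeast0LessThan intro!: sum.cong)
    also have "\<dots> = c (ws ! i) * c (ws ! j) * (\<Sum>k<n. cnj (ws ! i $ k) * ws ! j $ k)"
      using ij wsc[OF ij(1)] wsc[OF ij(2)] by (simp add: colW sum_distrib_left cc ac_simps)
    also have "(\<Sum>k<n. cnj (ws ! i $ k) * ws ! j $ k) = ws ! j \<bullet>c ws ! i"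
      using wsc[OF ij(1)] wsc[OF ij(2)]
      by (auto simp: scalar_prod_def atLeast0LessThan mult.commute intro!: sum.cong)
    also have "c (ws ! i) * c (ws ! j) * (ws ! j \<bullet>c ws ! i) = (if i = j then 1 else 0)"
    proof (cases "i = j")
      case True
      define r where "r = ws ! i \<bullet>c ws ! i"
      have "r \<ge> 0" unfolding r_def by (rule conjugate_square_ge_0_vec)
      moreover have "r \<noteq> 0" using orth[OF ij(1) ij(1)] by (simp add: r_def)
      ultimately obtain x where x: "r = complex_of_real x" "x > 0"
        by (metis complex_eq_cancel_iff2 complex_is_Real_iff less_eq_complex_def of_real_Re order_le_less zero_complex.simps(1) zero_complex.simps(2) complex_of_real_def of_real_0)
      have "c (ws ! i) = complex_of_real (1 / sqrt x)"
        by (simp add: c_def r_def[symmetric] x)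
      then have "c (ws ! i) * c (ws ! i) * r = complex_of_real (1 / sqrt x * (1 / sqrt x) * x)"
        unfolding x(1) by (simp only: of_real_mult)
      also have "1 / sqrt x * (1 / sqrt x) * x = 1"
        using x by (simp add: field_simps)
      finally show ?thesis using True by (simp add: r_def)
    next
      case False
      then show ?thesis using orth[OF ij(2) ij(1)] by simp
    qed
    finally show "(mat_adjoint W * W) $$ (i, j) = 1\<^sub>m n $$ (i, j)" using ij by simp
  qed (use W in auto)
  with W have "unitary n W" by (rule unitaryI)
  moreover have "ws ! 0 = v" using hd len n by (cases ws) auto
  then have "col W 0 = c v \<cdot>\<^sub>v v" using colW[OF n] by simp
  ultimately show thesis using that by blast
qed

lemma hermitian_congruence:
  assumes "hermitian n A" "X \<in> carrier_mat n k"
  shows "hermitian k (mat_adjoint X * A * X)"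
proof -
  have c: "A \<in> carrier_mat n n" "mat_adjoint X \<in> carrier_mat k n" "mat_adjoint A = A"
    using assms by (auto simp: hermitian_def)
  have XA: "mat_adjoint X * A \<in> carrier_mat k n" using c by simp
  have "mat_adjoint (mat_adjoint X * A * X) = mat_adjoint X * A * X"
    unfolding mat_adjoint_mult[OF XA assms(2)] mat_adjoint_mult[OF c(2,1)]
    using c assms(2) by (simp add: assoc_mult_mat[of _ k n _ n _ k])
  moreover have "mat_adjoint X * A * X \<in> carrier_mat k k" by (rule mult_carrier_mat[OF XA assms(2)])
  ultimately show ?thesis unfolding hermitian_def by blast
qed

lemma four_block_diag_adjoint:
  fixes A B :: "complex mat"
  assumes "A \<in> carrier_mat a a" "B \<in> carrier_mat b b"
  shows "mat_adjoint (four_block_mat A (0\<^sub>m a b) (0\<^sub>m b a) B)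
    = four_block_mat (mat_adjoint A) (0\<^sub>m a b) (0\<^sub>m b a) (mat_adjoint B)"
  using assms by (intro eq_matI) (auto simp: mat_adjoint_index)

lemma four_block_diag_mult:
  fixes A B :: "complex mat"
  assumes "A \<in> carrier_mat a a" "B \<in> carrier_mat b b" "C \<in> carrier_mat a a" "D \<in> carrier_mat b b"
  shows "four_block_mat A (0\<^sub>m a b) (0\<^sub>m b a) B * four_block_mat C (0\<^sub>m a b) (0\<^sub>m b a) D
    = four_block_mat (A * C) (0\<^sub>m a b) (0\<^sub>m b a) (B * D)"
  using assms by (subst mult_four_block_mat[of _ a a _ b _ b]) auto

text \<open>Deflation. The characteristic polynomial has a root, hence there is an eigenvector. In
  an orthonormal basis that starts with it, the first column of \<open>M\<close> is zero below its
  head, hermitian symmetry clears the first row too, and a hermitian block of size \<open>n\<close>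
  remains.\<close>

theorem hermitian_spectral:
  assumes "hermitian n A"
  obtains U l where "unitary n U" "A = U * dmat n l * mat_adjoint U"
proof -
  have "\<exists>U l. unitary n U \<and> A = U * dmat n l * mat_adjoint U" using assms
  proof (induction n arbitrary: A)
    case 0
    have "unitary 0 (1\<^sub>m 0)" by (auto intro: unitaryI)
    moreover have "A = 1\<^sub>m 0 * dmat 0 (\<lambda>_. 0) * mat_adjoint (1\<^sub>m 0)"
      using 0 by (auto simp: hermitian_def intro!: eq_matI)
    ultimately show ?case by blast
  next
    case (Suc n)
    let ?N = "Suc n"
    have A: "A \<in> carrier_mat ?N ?N" using Suc.prems by (simp add: hermitian_def)
    have "\<exists>e. eigenvalue A e"
    proof -
      have "\<not> constant (poly (char_poly A))"
        using degree_monic_char_poly[OF A] by (simp add: constant_degree)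
      then obtain e where "poly (char_poly A) e = 0"
        using fundamental_theorem_of_algebra by blast
      then show ?thesis using eigenvalue_root_char_poly[OF A] by auto
    qed
    then obtain e v where v: "v \<in> carrier_vec ?N" "v \<noteq> 0\<^sub>v ?N" "A *\<^sub>v v = e \<cdot>\<^sub>v v"
      using A by (auto simp: eigenvalue_def eigenvector_def)
    obtain W c where W: "unitary ?N W" "col W 0 = c \<cdot>\<^sub>v v"
      using unitary_with_first_column[OF v(1,2)] by blast
    have Wc: "W \<in> carrier_mat ?N ?N" "mat_adjoint W \<in> carrier_mat ?N ?N"
      using W by (auto simp: unitary_def)
    define M where "M = mat_adjoint W * A * W"
    have M: "hermitian ?N M" unfolding M_def by (rule hermitian_congruence[OF Suc.prems Wc(1)])
    have Mc: "M \<in> carrier_mat ?N ?N" using M by (simp add: hermitian_def)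
    have AW: "A *\<^sub>v col W 0 = e \<cdot>\<^sub>v col W 0"
      unfolding W(2) using v A by (simp add: mult_mat_vec smult_smult_assoc mult.commute)
    have "M = mat_adjoint W * (A * W)"
      unfolding M_def using A Wc by (simp add: assoc_mult_mat[of _ ?N ?N _ ?N _ ?N])
    then have "col M 0 = mat_adjoint W *\<^sub>v (A *\<^sub>v col W 0)"
      using A Wc col_mult2[OF Wc(2) mult_carrier_mat[OF A Wc(1)], of 0] col_mult2[OF A Wc(1), of 0]
      by (simp del: col_mult2)
    also have "\<dots> = e \<cdot>\<^sub>v (mat_adjoint W *\<^sub>v col W 0)"
      unfolding AW by (rule mult_mat_vec[OF Wc(2)]) (use Wc in \<open>simp add: carrier_vecI\<close>)
    also have "mat_adjoint W *\<^sub>v col W 0 = col (mat_adjoint W * W) 0"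
      using Wc by (simp add: col_mult2[of _ ?N ?N])
    also have "\<dots> = unit_vec ?N 0" using W by (simp add: unitary_def)
    finally have col0: "col M 0 = e \<cdot>\<^sub>v unit_vec ?N 0" .
    have Mi0: "M $$ (i, 0) = (if i = 0 then e else 0)" if "i < ?N" for i
      using arg_cong[OF col0, of "\<lambda>x. x $ i"] that Mc by auto
    have Msym: "M $$ (i, j) = cnj (M $$ (j, i))" if "i < ?N" "j < ?N" for i j
      using M Mc that mat_adjoint_index[of i M j] by (auto simp: hermitian_def)
    have M0j: "M $$ (0, j) = (if j = 0 then e else 0)" if "j < ?N" for j
      using Msym[of 0 j] Mi0[of j] Mi0[of 0] that Msym[of 0 0] by (auto split: if_splits)
    have ereal: "e = complex_of_real (Re e)"
      using Msym[of 0 0] Mi0[of 0] by (simp add: complex_eq_iff)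
    define A' where "A' = mat n n (\<lambda>(i, j). M $$ (Suc i, Suc j))"
    have hA': "hermitian n A'"
      unfolding hermitian_def A'_def by (auto simp: Msym[symmetric] intro!: eq_matI simp: mat_adjoint_index)
    obtain U l where U: "unitary n U" "A' = U * dmat n l * mat_adjoint U"
      using Suc.IH[OF hA'] by blast
    have Uc: "U \<in> carrier_mat n n" using U by (simp add: unitary_def)
    define V where "V = four_block_mat (1\<^sub>m 1) (0\<^sub>m 1 n) (0\<^sub>m n 1) U"
    have Vad: "mat_adjoint V = four_block_mat (1\<^sub>m 1) (0\<^sub>m 1 n) (0\<^sub>m n 1) (mat_adjoint U)"
      unfolding V_def using Uc by (subst four_block_diag_adjoint) auto
    have Vc: "V \<in> carrier_mat ?N ?N" "mat_adjoint V \<in> carrier_mat ?N ?N"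
      using four_block_carrier_mat[of "1\<^sub>m 1" 1 1 U n n] Uc by (auto simp: V_def)
    have "mat_adjoint V * V = four_block_mat (1\<^sub>m 1) (0\<^sub>m 1 n) (0\<^sub>m n 1) (1\<^sub>m n)"
      unfolding Vad unfolding V_def using Uc U(1)
      by (subst four_block_diag_mult) (auto simp: unitary_def)
    also have "\<dots> = 1\<^sub>m ?N" by (rule eq_matI) auto
    finally have uV: "unitary ?N V" by (intro unitaryI Vc)
    define l' where "l' = case_nat (Re e) l"
    have L: "dmat ?N l' = four_block_mat (mat 1 1 (\<lambda>_. e)) (0\<^sub>m 1 n) (0\<^sub>m n 1) (dmat n l)"
      using ereal by (intro eq_matI) (auto simp: dmat_def l'_def split: nat.split)
    have E: "mat 1 1 (\<lambda>_. e) \<in> carrier_mat 1 1" and D: "dmat n l \<in> carrier_mat n n"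
      by (auto simp: dmat_def)
    have "V * dmat ?N l' = four_block_mat (1\<^sub>m 1 * mat 1 1 (\<lambda>_. e)) (0\<^sub>m 1 n) (0\<^sub>m n 1) (U * dmat n l)"
      unfolding L unfolding V_def by (rule four_block_diag_mult[OF one_carrier_mat Uc E D])
    then have "V * dmat ?N l' * mat_adjoint V
        = four_block_mat (1\<^sub>m 1 * mat 1 1 (\<lambda>_. e) * 1\<^sub>m 1) (0\<^sub>m 1 n) (0\<^sub>m n 1) (U * dmat n l * mat_adjoint U)"
      unfolding Vad using Uc D
      by (simp only:) (rule four_block_diag_mult[OF mult_carrier_mat[OF one_carrier_mat E]
          mult_carrier_mat[OF Uc D] one_carrier_mat mat_adjoint_carrier[OF Uc]])
    also have "\<dots> = four_block_mat (mat 1 1 (\<lambda>_. e)) (0\<^sub>m 1 n) (0\<^sub>m n 1) A'"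
      by (simp only: left_mult_one_mat[OF E] right_mult_one_mat[OF E] U(2))
    also have "\<dots> = M"
      using Mc Mi0 M0j by (intro eq_matI) (auto simp: A'_def)
    finally have MV: "M = V * dmat ?N l' * mat_adjoint V" by simp
    have Lc: "dmat ?N l' \<in> carrier_mat ?N ?N" by (simp add: dmat_def)
    have "A = (W * mat_adjoint W) * A * (W * mat_adjoint W)"
      using W(1) A by (simp add: unitary_def)
    also have "\<dots> = W * M * mat_adjoint W"
      unfolding M_def using A Wc by (simp add: assoc_mult_mat[of _ ?N ?N _ ?N _ ?N])
    also have "\<dots> = (W * V) * dmat ?N l' * mat_adjoint (W * V)"
      unfolding MV mat_adjoint_mult[OF Wc(1) Vc(1)]
      using Wc Vc Lc by (simp add: assoc_mult_mat[of _ ?N ?N _ ?N _ ?N])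
    finally show ?case using unitary_mult[OF W(1) uV] by blast
  qed
  then show thesis using that by blast
qed

section \<open>Positive semidefinite matrices, square roots and traces\<close>

lemma dmat_carrier[simp]: "dmat n l \<in> carrier_mat n n"
  by (simp add: dmat_def)

lemma dmat_mult_left:
  "X \<in> carrier_mat n k \<Longrightarrow> dmat n l * X = mat n k (\<lambda>(i, j). complex_of_real (l i) * X $$ (i, j))"
  by (intro eq_matI) (auto simp: dmat_def scalar_prod_def if_distrib[of "\<lambda>x. x * _"] sum.delta cong: if_cong)

lemma dmat_mult_right:
  "X \<in> carrier_mat k n \<Longrightarrow> X * dmat n l = mat k n (\<lambda>(i, j). X $$ (i, j) * complex_of_real (l j))"
  by (intro eq_matI) (auto simp: dmat_def scalar_prod_def if_distrib[of "\<lambda>x. _ * x"] sum.delta cong: if_cong)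

lemma dmat_mult: "dmat n l * dmat n k = dmat n (\<lambda>i. l i * k i)"
  by (subst dmat_mult_left[of _ n n]) (auto simp: dmat_def intro!: eq_matI)

lemma unitaryD:
  assumes "unitary n U"
  shows "U \<in> carrier_mat n n" "mat_adjoint U \<in> carrier_mat n n"
    "mat_adjoint U * U = 1\<^sub>m n" "U * mat_adjoint U = 1\<^sub>m n"
  using assms by (auto simp: unitary_def)

lemma mult_cancel_middle:
  fixes U V X Y :: "complex mat"
  assumes "U * V = 1\<^sub>m n" "U \<in> carrier_mat n k" "V \<in> carrier_mat k n" "X \<in> carrier_mat r n" "Y \<in> carrier_mat n c"
  shows "(X * U) * (V * Y) = X * Y"
proof -
  have "(X * U) * (V * Y) = X * (U * V) * Y"
    using assms(2-) by (simp add: assoc_mult_mat[of _ r n _ k _ c] assoc_mult_mat[of _ n k _ n _ c]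
      assoc_mult_mat[of _ r n _ n _ c])
  then show ?thesis using assms by simp
qed

lemma unitary_conj_mult:
  assumes "unitary n U" "X \<in> carrier_mat n n" "Y \<in> carrier_mat n n"
  shows "(U * X * mat_adjoint U) * (U * Y * mat_adjoint U) = U * (X * Y) * mat_adjoint U"
proof -
  note U = unitaryD[OF assms(1)]
  have "(U * X * mat_adjoint U) * (U * Y * mat_adjoint U) = (U * X * mat_adjoint U) * (U * (Y * mat_adjoint U))"
    using U(1,2) assms by (simp add: assoc_mult_mat[of _ n n _ n _ n])
  also have "\<dots> = (U * X) * (Y * mat_adjoint U)"
    by (rule mult_cancel_middle[OF U(3,2,1)]) (use U assms in auto)
  also have "\<dots> = U * (X * Y) * mat_adjoint U"
    using U(1,2) assms by (simp add: assoc_mult_mat[of _ n n _ n _ n])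
  finally show ?thesis .
qed

text \<open>\<open>X\<close> may be rectangular, which covers compressions to a block as well as
  changes of basis.\<close>

lemma psd_congruence:
  assumes A: "psd n A" and X: "X \<in> carrier_mat n k"
  shows "psd k (mat_adjoint X * A * X)"
  unfolding psd_def
proof (intro conjI ballI)
  have c: "A \<in> carrier_mat n n" "mat_adjoint X \<in> carrier_mat k n" using assms by (auto simp: psd_def)
  show "mat_adjoint X * A * X \<in> carrier_mat k k"
    by (rule mult_carrier_mat[OF mult_carrier_mat[OF c(2,1)] X])
  fix v :: "complex vec" assume v: "v \<in> carrier_vec k"
  have "(mat_adjoint X * A * X) *\<^sub>v v = mat_adjoint X *\<^sub>v (A *\<^sub>v (X *\<^sub>v v))"
    using assoc_mult_mat_vec[OF mult_carrier_mat[OF c(2,1)] X v]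
      assoc_mult_mat_vec[OF c(2,1) mult_mat_vec_carrier[OF X v]] by simp
  then have "(mat_adjoint X * A * X *\<^sub>v v) \<bullet>c v = (A *\<^sub>v (X *\<^sub>v v)) \<bullet>c (X *\<^sub>v v)"
    using mat_adjoint_mult_vec[OF X _ v, of "A *\<^sub>v (X *\<^sub>v v)"] c X v by (simp only: mult_mat_vec_carrier)
  then show "0 \<le> (mat_adjoint X * A * X *\<^sub>v v) \<bullet>c v"
    using A X v by (simp add: psd_def)
qed

lemma psd_carrier: "psd n A \<Longrightarrow> A \<in> carrier_mat n n"
  by (simp add: psd_def)

lemma psd_dmat: "(\<And>i. i < n \<Longrightarrow> 0 \<le> l i) \<Longrightarrow> psd n (dmat n l)"
  unfolding psd_def
proof (intro conjI ballI)
  fix v :: "complex vec" assume l: "\<And>i. i < n \<Longrightarrow> 0 \<le> l i" and v: "v \<in> carrier_vec n"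
  have "dmat n l *\<^sub>v v = vec n (\<lambda>i. l i * v $ i)"
    using v by (intro eq_vecI) (auto simp: dmat_def scalar_prod_def if_distrib[of "\<lambda>x. x * _"] sum.delta cong: if_cong)
  moreover have "complex_of_real r * z * cnj z = complex_of_real (r * (cmod z)\<^sup>2)" for r z
    using complex_norm_square[of z] by (simp add: mult.assoc)
  ultimately have "(dmat n l *\<^sub>v v) \<bullet>c v = (\<Sum>i<n. complex_of_real (l i * (cmod (v $ i))\<^sup>2))"
    using v by (auto simp: scalar_prod_def atLeast0LessThan intro!: sum.cong)
  also have "\<dots> \<ge> 0" using l by (intro sum_nonneg) (simp add: less_eq_complex_def)
  finally show "0 \<le> (dmat n l *\<^sub>v v) \<bullet>c v" .
qed simp

lemma psd_one: "psd n (1\<^sub>m n)"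
proof -
  have "1\<^sub>m n = dmat n (\<lambda>_. 1)" by (intro eq_matI) (auto simp: dmat_def)
  then show ?thesis by (simp add: psd_dmat)
qed

lemma psd_gram: "X \<in> carrier_mat r n \<Longrightarrow> psd n (mat_adjoint X * X)"
  using psd_congruence[OF psd_one, of X r n] right_mult_one_mat[of "mat_adjoint X" n r] by simp

lemma quadratic_form_unit:
  fixes A :: "complex mat"
  assumes "A \<in> carrier_mat n n" "i < n" "j < n"
  shows "(A *\<^sub>v unit_vec n i) \<bullet>c unit_vec n j = A $$ (j, i)"
proof -
  have "conjugate (unit_vec n j :: complex vec) = unit_vec n j"
    by (intro eq_vecI) (auto simp: unit_vec_def)
  moreover have "A *\<^sub>v unit_vec n i = col A i"
    using assms by (intro eq_vecI) auto
  ultimately show ?thesis using assms by (simp add: carrier_vecI)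
qed

text \<open>Polarisation: the quadratic form is real at e_i + c e_j. The choice c = 1 compares the
  imaginary parts of the entries (i, j) and (j, i), the choice c = \<i> their real parts.\<close>

lemma psd_hermitian:
  assumes "psd n A" shows "hermitian n A"
proof -
  have A: "A \<in> carrier_mat n n" using assms by (simp add: psd_def)
  have sym: "A $$ (i, j) = cnj (A $$ (j, i))" if ij: "i < n" "j < n" for i j
  proof -
    have real: "Im ((A *\<^sub>v v) \<bullet>c v) = 0" if "v \<in> carrier_vec n" for v
      using assms that by (auto simp: psd_def less_eq_complex_def)
    have exp: "(A *\<^sub>v (unit_vec n i + c \<cdot>\<^sub>v unit_vec n j)) \<bullet>c (unit_vec n i + c \<cdot>\<^sub>v unit_vec n j)
      = A $$ (i, i) + c * A $$ (i, j) + cnj c * A $$ (j, i) + c * cnj c * A $$ (j, j)" for c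
    proof -
      have "A *\<^sub>v (unit_vec n i + c \<cdot>\<^sub>v unit_vec n j) = A *\<^sub>v unit_vec n i + c \<cdot>\<^sub>v (A *\<^sub>v unit_vec n j)"
        using A by (simp add: mult_add_distrib_mat_vec[of _ n n] mult_mat_vec[of _ n n])
      moreover have "conjugate (unit_vec n i + c \<cdot>\<^sub>v unit_vec n j)
        = conjugate (unit_vec n i) + cnj c \<cdot>\<^sub>v conjugate (unit_vec n j)"
        by (intro eq_vecI) auto
      ultimately show ?thesis
        using A ij by (simp add: add_scalar_prod_distrib[of _ n] scalar_prod_add_distrib[of _ n]
          quadratic_form_unit algebra_simps)
    qed
    have "Im (A $$ (i, i)) = 0" "Im (A $$ (j, j)) = 0"
      using real[of "unit_vec n i"] real[of "unit_vec n j"] quadratic_form_unit[OF A] ij by auto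
    moreover have "Im (A $$ (i, i) + c * A $$ (i, j) + cnj c * A $$ (j, i) + c * cnj c * A $$ (j, j)) = 0" for c
      unfolding exp[symmetric] by (rule real) simp
    from this[of 1] this[of \<i>] have "Im (A $$ (i, i)) + Im (A $$ (i, j)) + Im (A $$ (j, i)) + Im (A $$ (j, j)) = 0"
      "Im (A $$ (i, i)) + Re (A $$ (i, j)) - Re (A $$ (j, i)) + Im (A $$ (j, j)) = 0"
      by auto
    ultimately show ?thesis by (simp add: complex_eq_iff)
  qed
  show ?thesis unfolding hermitian_def using A by (auto simp: mat_adjoint_index sym[symmetric] intro!: eq_matI)
qed

lemma psd_adjoint: "psd n A \<Longrightarrow> mat_adjoint A = A"
  using psd_hermitian by (simp add: hermitian_def)

lemma psd_diag_nonneg: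
  assumes "psd n A" "i < n" shows "0 \<le> A $$ (i, i)"
proof -
  have "0 \<le> (A *\<^sub>v unit_vec n i) \<bullet>c unit_vec n i"
    using assms(1) unit_vec_carrier[of n i] unfolding psd_def by blast
  then show ?thesis using quadratic_form_unit[of A n i i] psd_carrier[OF assms(1)] assms(2) by simp
qed

lemma psd_spectral:
  assumes "psd n A"
  obtains U l where "unitary n U" "A = U * dmat n l * mat_adjoint U" "\<And>i. i < n \<Longrightarrow> 0 \<le> l i"
proof -
  obtain U l where U: "unitary n U" and A: "A = U * dmat n l * mat_adjoint U"
    using hermitian_spectral[OF psd_hermitian[OF assms]] by blast
  note Ud = unitaryD[OF U]
  \<comment> \<open>Undoing the change of basis shows the diagonal matrix to be positive, and its
    diagonal entries are the eigenvalues.\<close>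
  have "mat_adjoint U * A * U = (mat_adjoint U * U) * dmat n l * (mat_adjoint U * U)"
    unfolding A using Ud(1,2) by (simp add: assoc_mult_mat[of _ n n _ n _ n])
  also have "\<dots> = dmat n l"
    unfolding Ud by (simp add: left_mult_one_mat[of _ n n] right_mult_one_mat[of _ n n])
  finally have "psd n (dmat n l)"
    using psd_congruence[OF assms Ud(1)] by simp
  then have "0 \<le> l i" if "i < n" for i
    using psd_diag_nonneg[OF _ that] that by (fastforce simp: dmat_def less_eq_complex_def)
  then show thesis using that U A by blast
qed

lemma psd_unitary_dmat:
  assumes "unitary n U" "\<And>i. i < n \<Longrightarrow> 0 \<le> l i"
  shows "psd n (U * dmat n l * mat_adjoint U)"
  using psd_congruence[OF psd_dmat[of n l] unitaryD(2)[OF assms(1)]] assms by simp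

section \<open>Existence and uniqueness of the positive square root\<close>

lemma psd_sqrt_exists:
  assumes "psd n A" obtains B where "psd n B" "B * B = A"
proof -
  obtain U l where U: "unitary n U" and A: "A = U * dmat n l * mat_adjoint U" and l: "\<And>i. i < n \<Longrightarrow> 0 \<le> l i"
    using psd_spectral[OF assms] by blast
  let ?B = "U * dmat n (\<lambda>i. sqrt (l i)) * mat_adjoint U"
  have "psd n ?B" by (rule psd_unitary_dmat[OF U]) (simp add: l)
  moreover have "?B * ?B = U * dmat n (\<lambda>i. sqrt (l i) * sqrt (l i)) * mat_adjoint U"
    by (simp add: unitary_conj_mult[OF U] dmat_mult)
  moreover have "dmat n (\<lambda>i. sqrt (l i) * sqrt (l i)) = dmat n l"
    using l by (intro eq_matI) (auto simp: dmat_def)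
  ultimately show thesis using that A by simp
qed

text \<open>This is what makes the definite description in \<open>psd_sqrt\<close> denote. The
  overlap matrix \<open>W\<close> of the two eigenbases intertwines the squared spectra, so an entry
  W_ij other than 0 forces b_i^2 = c_j^2. Nonnegativity gives b_i = c_j, and \<open>W\<close>
  intertwines the spectra themselves.\<close>

lemma psd_sqrt_unique:
  assumes "psd n B" "psd n C" "B * B = C * C"
  shows "B = C"
proof -
  obtain U b where U: "unitary n U" and B: "B = U * dmat n b * mat_adjoint U" and b: "\<And>i. i < n \<Longrightarrow> 0 \<le> b i"
    using psd_spectral[OF assms(1)] by blast
  obtain V c where V: "unitary n V" and C: "C = V * dmat n c * mat_adjoint V" and c: "\<And>i. i < n \<Longrightarrow> 0 \<le> c i"
    using psd_spectral[OF assms(2)] by blast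
  note Ud = unitaryD[OF U] and Vd = unitaryD[OF V]
  define W where "W = mat_adjoint U * V"
  have W: "W \<in> carrier_mat n n" using Ud Vd by (simp add: W_def)
  \<comment> \<open>Used from right to left for the squares and from left to right for the
    roots.\<close>
  have intertwine: "dmat n x * W = W * dmat n y \<longleftrightarrow>
    U * dmat n x * mat_adjoint U = V * dmat n y * mat_adjoint V" (is "?l \<longleftrightarrow> ?r") for x y
  proof
    assume ?l
    have "U * dmat n x * mat_adjoint U = U * (dmat n x * W) * mat_adjoint V"
      unfolding W_def using Ud(1,2) Vd by (simp add: assoc_mult_mat[of _ n n _ n _ n])
    also have "\<dots> = (U * mat_adjoint U) * V * dmat n y * mat_adjoint V"
      unfolding \<open>?l\<close> unfolding W_def using Ud(1,2) Vd(1,2) by (simp add: assoc_mult_mat[of _ n n _ n _ n])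
    finally show ?r using Ud Vd by simp
  next
    assume ?r
    have "dmat n x * W = (mat_adjoint U * U) * dmat n x * (mat_adjoint U * V)"
      unfolding W_def Ud(3) by simp
    also have "\<dots> = mat_adjoint U * (U * dmat n x * mat_adjoint U) * V"
      using Ud(1,2) Vd(1,2) by (simp add: assoc_mult_mat[of _ n n _ n _ n])
    also have "\<dots> = W * dmat n y * (mat_adjoint V * V)"
      unfolding \<open>?r\<close> W_def using Ud(1,2) Vd(1,2) by (simp add: assoc_mult_mat[of _ n n _ n _ n])
    finally show ?l using Vd W by simp
  qed
  have "dmat n (\<lambda>i. b i * b i) * W = W * dmat n (\<lambda>i. c i * c i)"
    unfolding intertwine using assms(3)
    by (simp add: B C unitary_conj_mult[OF U] unitary_conj_mult[OF V] dmat_mult)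
  then have entry: "complex_of_real (b i * b i) * W $$ (i, j) = W $$ (i, j) * complex_of_real (c j * c j)"
    if "i < n" "j < n" for i j
    using that arg_cong[of _ _ "\<lambda>M. M $$ (i, j)"] W
    by (fastforce simp: dmat_mult_left[OF W] dmat_mult_right[OF W])
  have "complex_of_real (b i) * W $$ (i, j) = W $$ (i, j) * complex_of_real (c j)"
    if ij: "i < n" "j < n" for i j
  proof (cases "W $$ (i, j) = 0")
    case False
    then have "b i * b i = c j * c j"
      using entry[OF ij] by (metis mult.commute mult_cancel_right of_real_eq_iff)
    then have "b i = c j" using b[OF ij(1)] c[OF ij(2)]
      by (metis abs_of_nonneg power2_eq_iff power2_eq_square abs_minus_cancel)
    then show ?thesis by simp
  qed simp
  then have "dmat n b * W = W * dmat n c"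
    using W by (intro eq_matI) (auto simp: dmat_mult_left[OF W] dmat_mult_right[OF W])
  then show ?thesis unfolding intertwine B C .
qed

lemma psd_sqrt_eq: "psd n B \<Longrightarrow> B * B = A \<Longrightarrow> psd_sqrt A = B"
proof -
  assume B: "psd n B" and A: "B * B = A"
  then have d: "dim_row A = n" using psd_carrier[OF B] by auto
  show ?thesis unfolding psd_sqrt_def d
  proof (rule the_equality)
    show "psd n B \<and> B * B = A" using B A by simp
    fix C assume "psd n C \<and> C * C = A"
    then show "C = B" using psd_sqrt_unique[of n C B] B A by simp
  qed
qed

lemma
  assumes "psd n A"
  shows psd_psd_sqrt: "psd n (psd_sqrt A)" and psd_sqrt_square: "psd_sqrt A * psd_sqrt A = A"
proof -
  obtain B where "psd n B" "B * B = A" using psd_sqrt_exists[OF assms] by blast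
  then show "psd n (psd_sqrt A)" "psd_sqrt A * psd_sqrt A = A" using psd_sqrt_eq by auto
qed

section \<open>Traces of products of positive matrices\<close>

lemma mat_trace_comm:
  assumes "A \<in> carrier_mat r c" "B \<in> carrier_mat c r"
  shows "mat_trace (A * B) = mat_trace (B * A)"
proof -
  have "mat_trace (A * B) = (\<Sum>i<r. \<Sum>j<c. A $$ (i, j) * B $$ (j, i))"
    using assms by (auto simp: mat_trace_def scalar_prod_def atLeast0LessThan intro!: sum.cong)
  also have "\<dots> = (\<Sum>j<c. \<Sum>i<r. A $$ (i, j) * B $$ (j, i))" by (rule sum.swap)
  also have "\<dots> = mat_trace (B * A)"
    using assms by (auto simp: mat_trace_def scalar_prod_def atLeast0LessThan mult.commute intro!: sum.cong)
  finally show ?thesis .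
qed

lemma mat_trace_add: "A \<in> carrier_mat n n \<Longrightarrow> B \<in> carrier_mat n n \<Longrightarrow> mat_trace (A + B) = mat_trace A + mat_trace B"
  by (simp add: mat_trace_def sum.distrib)

lemma mat_trace_diff: "A \<in> carrier_mat n n \<Longrightarrow> B \<in> carrier_mat n n \<Longrightarrow> mat_trace (A - B) = mat_trace A - mat_trace B"
  by (simp add: mat_trace_def sum_subtractf)

lemma mat_trace_smult: "A \<in> carrier_mat n n \<Longrightarrow> mat_trace (c \<cdot>\<^sub>m A) = c * mat_trace A"
  by (simp add: mat_trace_def sum_distrib_left)

lemma mat_trace_unitary_conj:
  assumes "unitary n U" "X \<in> carrier_mat n n"
  shows "mat_trace (U * X * mat_adjoint U) = mat_trace X"
proof -
  note U = unitaryD[OF assms(1)]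
  have "mat_trace (U * X * mat_adjoint U) = mat_trace (U * (X * mat_adjoint U))"
    using U(1,2) assms by (simp add: assoc_mult_mat[of _ n n _ n _ n])
  also have "\<dots> = mat_trace (X * mat_adjoint U * U)"
    by (rule mat_trace_comm[of _ n n]) (use U assms in auto)
  also have "X * mat_adjoint U * U = X"
    using U assms by (simp add: assoc_mult_mat[of _ n n _ n _ n])
  finally show ?thesis .
qed

lemma mat_trace_dmat: "mat_trace (dmat n l) = complex_of_real (\<Sum>i<n. l i)"
  by (simp add: mat_trace_def dmat_def)

lemma psd_trace_nonneg: assumes "psd n A" shows "0 \<le> mat_trace A"
proof -
  have "dim_row A = n" using psd_carrier[OF assms] by simp
  then show ?thesis unfolding mat_trace_def by (intro sum_nonneg psd_diag_nonneg[OF assms]) simp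
qed

text \<open>\<open>A * B\<close> need not be hermitian, but its trace equals that of
  \<open>R * B * R\<close>, where \<open>R\<close> is the root of \<open>A\<close>.\<close>

lemma psd_trace_mult_nonneg:
  assumes "psd n A" "psd n B" shows "0 \<le> mat_trace (A * B)"
proof -
  define R where "R = psd_sqrt A"
  have R: "psd n R" "R * R = A" using psd_psd_sqrt psd_sqrt_square assms by (auto simp: R_def)
  have c: "R \<in> carrier_mat n n" "B \<in> carrier_mat n n" using R assms by (auto simp: psd_def)
  have "mat_trace (A * B) = mat_trace (R * (R * B))"
    using R(2) c by (metis assoc_mult_mat)
  also have "\<dots> = mat_trace (mat_adjoint R * B * R)"
    using c by (subst mat_trace_comm[of _ n n]) (auto simp: psd_adjoint[OF R(1)])
  also have "\<dots> \<ge> 0" by (rule psd_trace_nonneg[OF psd_congruence[OF assms(2) c(1)]])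
  finally show ?thesis .
qed

lemma psd_trace_mult_mono:
  assumes "psd n C" "psd n (B - A)" "A \<in> carrier_mat n n" "B \<in> carrier_mat n n"
  shows "mat_trace (C * A) \<le> mat_trace (C * B)"
proof -
  have C: "C \<in> carrier_mat n n" using assms by (simp add: psd_def)
  have "C * (B - A) = C * B - C * A" using C assms by (simp add: mult_minus_distrib_mat[of _ n n])
  then have "mat_trace (C * B) - mat_trace (C * A) = mat_trace (C * (B - A))"
    using C assms by (simp add: mat_trace_diff[of _ n])
  also have "\<dots> \<ge> 0" by (rule psd_trace_mult_nonneg[OF assms(1,2)])
  finally show ?thesis by simp
qed

text \<open>In an eigenbasis of \<open>A\<close> the trace of the product is the sum of a_i C_ii,
  and no diagonal entry C_ii exceeds the trace of \<open>B\<close>. The bound is crude; it serves to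
  show that the supremum in \<open>H_max\<close> is finite.\<close>

lemma psd_trace_mult_le:
  assumes "psd n A" "psd n B"
  shows "Re (mat_trace (A * B)) \<le> Re (mat_trace A) * Re (mat_trace B)"
proof -
  obtain U a where U: "unitary n U" and A: "A = U * dmat n a * mat_adjoint U" and a: "\<And>i. i < n \<Longrightarrow> 0 \<le> a i"
    using psd_spectral[OF assms(1)] by blast
  note Ud = unitaryD[OF U]
  have Bc: "B \<in> carrier_mat n n" using assms by (simp add: psd_def)
  define C where "C = mat_adjoint U * B * U"
  have C: "psd n C" unfolding C_def by (rule psd_congruence[OF assms(2) Ud(1)])
  have Cc: "C \<in> carrier_mat n n" using C by (simp add: psd_def)
  have d: "0 \<le> Re (C $$ (i, i))" if "i < n" for i
    using psd_diag_nonneg[OF C that] by (simp add: less_eq_complex_def)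
  have B: "B = U * C * mat_adjoint U"
  proof -
    have "U * C * mat_adjoint U = (U * mat_adjoint U) * B * (U * mat_adjoint U)"
      unfolding C_def using Ud(1,2) Bc by (simp add: assoc_mult_mat[of _ n n _ n _ n])
    then show ?thesis using Ud Bc by simp
  qed
  have trB: "Re (mat_trace B) = (\<Sum>i<n. Re (C $$ (i, i)))"
    unfolding B mat_trace_unitary_conj[OF U Cc] using Cc by (simp add: mat_trace_def)
  have "A * B = U * (dmat n a * C) * mat_adjoint U"
    unfolding A B by (rule unitary_conj_mult[OF U]) (use Cc in auto)
  then have "mat_trace (A * B) = mat_trace (dmat n a * C)"
    using mat_trace_unitary_conj[OF U, of "dmat n a * C"] Cc by (simp add: mult_carrier_mat[of _ n n])
  then have "Re (mat_trace (A * B)) = (\<Sum>i<n. a i * Re (C $$ (i, i)))"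
    by (simp add: mat_trace_def dmat_mult_left[OF Cc])
  also have "\<dots> \<le> (\<Sum>i<n. a i * Re (mat_trace B))"
  proof (intro sum_mono mult_left_mono)
    fix i assume "i \<in> {..<n}"
    then show "Re (C $$ (i, i)) \<le> Re (mat_trace B)"
      unfolding trB by (intro member_le_sum) (auto intro: d)
  qed (use a in auto)
  also have "\<dots> = Re (mat_trace A) * Re (mat_trace B)"
    unfolding A mat_trace_unitary_conj[OF U dmat_carrier] by (simp add: mat_trace_dmat sum_distrib_right)
  finally show ?thesis .
qed

section \<open>Fidelity versus collision\<close>

text \<open>Cauchy-Schwarz in a form without roots: each use only has to check a monomial
  identity.\<close>

lemma sum_squared_le:
  fixes f g h :: "nat \<Rightarrow> real"
  assumes "\<And>i. i < n \<Longrightarrow> 0 \<le> f i" "\<And>i. i < n \<Longrightarrow> 0 \<le> h i"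
    "\<And>i. i < n \<Longrightarrow> 0 \<le> g i" "\<And>i. i < n \<Longrightarrow> (g i)\<^sup>2 = f i * h i"
  shows "(\<Sum>i<n. g i)\<^sup>2 \<le> (\<Sum>i<n. f i) * (\<Sum>i<n. h i)"
proof -
  have "g i = sqrt (f i) * sqrt (h i)" if "i < n" for i
    using assms(3,4)[OF that] by (metis real_sqrt_mult real_sqrt_abs abs_of_nonneg)
  then have "(\<Sum>i<n. g i)\<^sup>2 = (\<Sum>i<n. sqrt (f i) * sqrt (h i))\<^sup>2" by simp
  also have "\<dots> \<le> (\<Sum>i<n. (sqrt (f i))\<^sup>2) * (\<Sum>i<n. (sqrt (h i))\<^sup>2)"
    by (rule Cauchy_Schwarz_ineq_sum)
  also have "\<dots> = (\<Sum>i<n. f i) * (\<Sum>i<n. h i)" using assms(1,2) by simp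
  finally show ?thesis .
qed

text \<open>Cancels one factor \<open>x\<close>, also for \<open>x = 0\<close>. Both of the next two
  arguments end in this shape.\<close>

lemma cube_le_of_power4_le:
  fixes x a :: real
  assumes "0 \<le> x" "0 \<le> a" "x ^ 4 \<le> x * a" shows "x ^ 3 \<le> a"
proof (cases "x = 0")
  case False
  have "x * x ^ 3 \<le> x * a" using assms(3) by (simp add: power_numeral_reduce)
  then show ?thesis using False assms(1) by (simp add: mult_le_cancel_left)
qed (use assms in simp)

text \<open>For the moments M_k of a probability distribution, M_2^2 <= M_1 M_3 and M_1^2 <= M_0 M_2
  = M_2. Together they give M_2^4 <= M_2 M_3^2.\<close>

lemma weighted_moment_ineq:
  fixes w e :: "nat \<Rightarrow> real"
  assumes w: "\<And>i. i < n \<Longrightarrow> 0 \<le> w i" and e: "\<And>i. i < n \<Longrightarrow> 0 \<le> e i" and w1: "(\<Sum>i<n. w i) = 1"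
  shows "(\<Sum>i<n. w i * e i ^ 2) ^ 3 \<le> (\<Sum>i<n. w i * e i ^ 3)\<^sup>2"
proof -
  define a where "a = (\<Sum>i<n. w i * e i)"
  define x where "x = (\<Sum>i<n. w i * e i ^ 2)"
  define y where "y = (\<Sum>i<n. w i * e i ^ 3)"
  have "x\<^sup>2 \<le> a * y" unfolding x_def a_def y_def
    by (intro sum_squared_le) (auto simp: w e power2_eq_square power3_eq_cube)
  then have "(x\<^sup>2)\<^sup>2 \<le> (a * y)\<^sup>2" by (intro power_mono) auto
  moreover have "a\<^sup>2 \<le> (\<Sum>i<n. w i) * x" unfolding x_def a_def
    by (intro sum_squared_le) (auto simp: w e power2_eq_square)
  then have "a\<^sup>2 * y\<^sup>2 \<le> x * y\<^sup>2" unfolding w1 by (intro mult_right_mono) auto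
  ultimately have "x ^ 4 \<le> x * y\<^sup>2" by (simp add: power_mult_distrib)
  moreover have "0 \<le> x" unfolding x_def by (intro sum_nonneg) (auto simp: w)
  ultimately show ?thesis unfolding x_def[symmetric] y_def[symmetric] by (intro cube_le_of_power4_le) auto
qed

text \<open>Hoelder with exponents 3/2 and 3 for the factorisation p^2 x = p^(2/3) (p^4 x^3)^(1/3).
  It comes from two uses of Cauchy-Schwarz, because p, p^2 x, p^3 x^2, p^4 x^3 is a geometric
  progression; \<open>Y\<close> is the sum of its third member.\<close>

lemma hoelder_chain:
  fixes p x z :: "nat \<Rightarrow> real"
  assumes p: "\<And>i. i < n \<Longrightarrow> 0 \<le> p i" and x: "\<And>i. i < n \<Longrightarrow> 0 \<le> x i"
    and z: "\<And>i. i < n \<Longrightarrow> x i ^ 3 \<le> z i"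
  shows "(\<Sum>i<n. p i ^ 2 * x i) ^ 3 \<le> (\<Sum>i<n. p i)\<^sup>2 * (\<Sum>i<n. p i ^ 4 * z i)"
proof -
  define t where "t = (\<Sum>i<n. p i ^ 2 * x i)"
  define F where "F = (\<Sum>i<n. p i)"
  define Y where "Y = (\<Sum>i<n. p i ^ 3 * x i ^ 2)"
  define X where "X = (\<Sum>i<n. p i ^ 4 * x i ^ 3)"
  have t0: "0 \<le> t" unfolding t_def by (intro sum_nonneg) (auto simp: x)
  have X0: "0 \<le> X" unfolding X_def by (intro sum_nonneg) (auto simp: x)
  have "t\<^sup>2 \<le> F * Y" unfolding t_def F_def Y_def
    by (intro sum_squared_le) (auto simp: p x power2_eq_square power3_eq_cube)
  then have "(t\<^sup>2)\<^sup>2 \<le> (F * Y)\<^sup>2" by (intro power_mono) auto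
  moreover have "Y\<^sup>2 \<le> t * X" unfolding t_def X_def Y_def
    by (intro sum_squared_le) (auto simp: p x eval_nat_numeral)
  then have "F\<^sup>2 * Y\<^sup>2 \<le> F\<^sup>2 * (t * X)" by (intro mult_left_mono) auto
  ultimately have "t ^ 4 \<le> t * (F\<^sup>2 * X)" by (simp add: power_mult_distrib ac_simps)
  then have "t ^ 3 \<le> F\<^sup>2 * X" using t0 X0 by (intro cube_le_of_power4_le) auto
  also have "X \<le> (\<Sum>i<n. p i ^ 4 * z i)" unfolding X_def
    by (intro sum_mono mult_left_mono) (auto simp: z)
  then have "F\<^sup>2 * X \<le> F\<^sup>2 * (\<Sum>i<n. p i ^ 4 * z i)" by (intro mult_left_mono) auto
  finally show ?thesis unfolding t_def F_def .
qed

lemma mult_conj_cmod_square: "z * cnj z = complex_of_real (cmod z) * complex_of_real (cmod z)"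
  by (metis complex_norm_square of_real_mult power2_eq_square)

lemma unitary_conj_diag_entry:
  assumes "unitary n U" "i < n"
  shows "(U * dmat n l * mat_adjoint U) $$ (i, i) = complex_of_real (\<Sum>j<n. (cmod (U $$ (i, j)))\<^sup>2 * l j)"
proof -
  note U = unitaryD[OF assms(1)]
  have "(U * dmat n l * mat_adjoint U) $$ (i, i) = (\<Sum>j<n. U $$ (i, j) * complex_of_real (l j) * cnj (U $$ (i, j)))"
    unfolding dmat_mult_right[OF U(1)] using U(1) assms(2)
    by (auto simp: scalar_prod_def mat_adjoint_index atLeast0LessThan intro!: sum.cong)
  also have "\<dots> = (\<Sum>j<n. complex_of_real ((cmod (U $$ (i, j)))\<^sup>2 * l j))"
    by (intro sum.cong refl) (simp add: complex_norm_square[unfolded of_real_power] ac_simps)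
  finally show ?thesis by simp
qed

text \<open>The i-th diagonal entry of E^k is the k-th moment of the eigenvalues of \<open>E\<close>
  under the weights |U_ij|^2, which sum to 1 over j. The first inequality becomes the hypothesis on
  \<open>z\<close> in \<open>hoelder_chain\<close>.\<close>

lemma psd_diag_moment_ineq:
  assumes E: "psd n E" and i: "i < n"
  shows "Re ((E * E) $$ (i, i)) ^ 3 \<le> (Re ((E * E * E) $$ (i, i)))\<^sup>2"
    and "0 \<le> Re ((E * E) $$ (i, i))"
proof -
  obtain U l where U: "unitary n U" and E: "E = U * dmat n l * mat_adjoint U" and l: "\<And>i. i < n \<Longrightarrow> 0 \<le> l i"
    using psd_spectral[OF E] by blast
  note Ud = unitaryD[OF U]
  have EE: "E * E = U * dmat n (\<lambda>i. l i ^ 2) * mat_adjoint U"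
    unfolding E by (simp add: unitary_conj_mult[OF U] dmat_mult power2_eq_square)
  have EEE: "E * E * E = U * dmat n (\<lambda>i. l i ^ 3) * mat_adjoint U"
    unfolding EE unfolding E
    by (simp add: unitary_conj_mult[OF U] dmat_mult power2_eq_square power3_eq_cube)
  have "U * dmat n (\<lambda>_. 1) * mat_adjoint U = 1\<^sub>m n"
  proof -
    have "dmat n (\<lambda>_. 1) = 1\<^sub>m n" by (intro eq_matI) (auto simp: dmat_def)
    then show ?thesis using Ud by simp
  qed
  from arg_cong[OF this, of "\<lambda>M. Re (M $$ (i, i))"] have w1: "(\<Sum>j<n. (cmod (U $$ (i, j)))\<^sup>2) = 1"
    unfolding unitary_conj_diag_entry[OF U i] using i by simp
  show "Re ((E * E) $$ (i, i)) ^ 3 \<le> (Re ((E * E * E) $$ (i, i)))\<^sup>2"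
    unfolding EEE unfolding EE unitary_conj_diag_entry[OF U i] Re_complex_of_real
    by (rule weighted_moment_ineq) (auto simp: w1 l)
  show "0 \<le> Re ((E * E) $$ (i, i))"
    unfolding EE unitary_conj_diag_entry[OF U i] Re_complex_of_real by (intro sum_nonneg) auto
qed

text \<open>For M = \<open>psd_sqrt A * G\<close> the product of the adjoint of M with M is
  \<open>G * A * G\<close>, so the root of \<open>A\<close> disappears.\<close>

lemma trace_norm_eq_trace_psd_sqrt_sandwich:
  assumes A: "psd n A" and G: "psd n G"
  shows "trace_norm (psd_sqrt A * G) = Re (mat_trace (psd_sqrt (G * A * G)))"
proof -
  define R where "R = psd_sqrt A"
  have R: "psd n R" "R * R = A" using psd_psd_sqrt psd_sqrt_square A by (auto simp: R_def)
  have c: "R \<in> carrier_mat n n" "G \<in> carrier_mat n n" using R G by (auto simp: psd_def)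
  have "mat_adjoint (R * G) * (R * G) = (G * R) * (R * G)"
    by (simp add: mat_adjoint_mult[OF c] psd_adjoint[OF R(1)] psd_adjoint[OF G])
  also have "\<dots> = G * (R * R) * G"
    using c by (simp add: assoc_mult_mat[of _ n n _ n _ n])
  finally show ?thesis unfolding trace_norm_def R_def[symmetric] R(2) by simp
qed

lemma psd_sandwich:
  assumes "psd n A" "psd n G" shows "psd n (G * A * G)"
  using psd_congruence[OF assms(1) psd_carrier[OF assms(2)]] psd_adjoint[OF assms(2)] by simp

text \<open>Cauchy-Schwarz on the \<open>n\<close> singular values of \<open>psd_sqrt A * G\<close>
  costs the factor \<open>n\<close>, which is harmless because only finiteness is wanted.\<close>

lemma trace_norm_upper_bound:
  assumes A: "psd n A" and G: "psd n G"
  shows "(trace_norm (psd_sqrt A * G))\<^sup>2 \<le> real n * (Re (mat_trace A) * Re (mat_trace (G * G)))"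
proof -
  have c: "A \<in> carrier_mat n n" "G \<in> carrier_mat n n" using assms by (auto simp: psd_def)
  note S = psd_sandwich[OF A G]
  define P where "P = psd_sqrt (G * A * G)"
  have P: "psd n P" "P * P = G * A * G" using psd_psd_sqrt psd_sqrt_square S by (auto simp: P_def)
  obtain U p where U: "unitary n U" and PU: "P = U * dmat n p * mat_adjoint U" and p: "\<And>i. i < n \<Longrightarrow> 0 \<le> p i"
    using psd_spectral[OF P(1)] by blast
  have "(trace_norm (psd_sqrt A * G))\<^sup>2 = (\<Sum>i<n. p i)\<^sup>2"
    unfolding trace_norm_eq_trace_psd_sqrt_sandwich[OF A G] P_def[symmetric]
    unfolding PU mat_trace_unitary_conj[OF U dmat_carrier] mat_trace_dmat by simp
  also have "\<dots> \<le> (\<Sum>i<n. 1) * (\<Sum>i<n. p i * p i)"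
    by (rule sum_squared_le) (auto simp: p power2_eq_square)
  also have "(\<Sum>i<n. p i * p i) = Re (mat_trace (P * P))"
    unfolding PU by (simp add: unitary_conj_mult[OF U] dmat_mult mat_trace_unitary_conj[OF U] mat_trace_dmat)
  also have "mat_trace (P * P) = mat_trace (A * (G * G))"
  proof -
    have "mat_trace (P * P) = mat_trace (G * (A * G))"
      unfolding P(2) using c by (simp add: assoc_mult_mat[of _ n n _ n _ n])
    also have "\<dots> = mat_trace (A * G * G)" by (rule mat_trace_comm[of _ n n]) (use c in auto)
    finally show ?thesis using c by (simp add: assoc_mult_mat[of _ n n _ n _ n])
  qed
  also have "(\<Sum>i<n. 1) * Re (mat_trace (A * (G * G))) \<le> real n * (Re (mat_trace A) * Re (mat_trace (G * G)))"
    using psd_trace_mult_le[OF A, of "G * G"] psd_gram[OF c(2)] psd_adjoint[OF G]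
    by (simp add: mult_left_mono)
  finally show ?thesis .
qed

text \<open>
  In an eigenbasis of \<open>sqrt (G A G)\<close> with eigenvalues \<open>p\<close>, and with \<open>E\<close> the matrix of \<open>D\<close>,
  the three quantities are power sums of \<open>p\<close> weighted by entries of \<open>E\<close>; dropping the off-diagonal
  entries of \<open>E\<^sup>3\<close> from the collision term leaves an instance of Hoelder's inequality.
\<close>

theorem trace_cubed_le_trace_norm_collision:
  assumes A: "psd n A" and G: "psd n G" and D: "psd n D" and GD: "G * D = 1\<^sub>m n"
  shows "Re (mat_trace A) ^ 3 \<le> (trace_norm (psd_sqrt A * G))\<^sup>2 * Re (mat_trace (A * D * (A * D)))"
proof -
  have c: "A \<in> carrier_mat n n" "G \<in> carrier_mat n n" "D \<in> carrier_mat n n"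
    using assms by (auto simp: psd_def)
  have DG: "D * G = 1\<^sub>m n" by (rule mat_mult_left_right_inverse[OF c(2,3) GD])
  note S = psd_sandwich[OF A G]
  define P where "P = psd_sqrt (G * A * G)"
  have P: "psd n P" "P * P = G * A * G" using psd_psd_sqrt psd_sqrt_square S by (auto simp: P_def)
  obtain U p where U: "unitary n U" and PU: "P = U * dmat n p * mat_adjoint U" and p: "\<And>i. i < n \<Longrightarrow> 0 \<le> p i"
    using psd_spectral[OF P(1)] by blast
  note Ud = unitaryD[OF U]
  define E where "E = mat_adjoint U * D * U"
  have E: "psd n E" unfolding E_def by (rule psd_congruence[OF D Ud(1)])
  have Ec: "E \<in> carrier_mat n n" using E by (simp add: psd_def)
  have DE: "D = U * E * mat_adjoint U"
  proof -
    have "U * E * mat_adjoint U = (U * mat_adjoint U) * D * (U * mat_adjoint U)"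
      unfolding E_def using Ud(1,2) c by (simp add: assoc_mult_mat[of _ n n _ n _ n])
    then show ?thesis using Ud c by simp
  qed
  define L where "L = dmat n (\<lambda>i. p i * p i)"
  have L: "L \<in> carrier_mat n n" by (simp add: L_def)
  have PP: "P * P = U * L * mat_adjoint U"
    unfolding PU L_def by (simp add: unitary_conj_mult[OF U] dmat_mult)
  \<comment> \<open>Since \<open>D\<close> inverts \<open>G\<close>, the modulus determines
    \<open>A\<close> as D P^2 D, which is E L E in the eigenbasis. Cyclicity then gives Tr A = Tr(L
    E^2) and Tr(A D A D) = Tr(E^3 L E^3 L). As E^3 is hermitian, the latter is a double sum of
    nonnegative terms.\<close>
  have "A = (D * G) * A * (G * D)" using c by (simp add: GD DG)
  also have "\<dots> = D * (P * P) * D"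
    unfolding P(2) using c by (simp add: assoc_mult_mat[of _ n n _ n _ n])
  also have "\<dots> = U * (E * L * E) * mat_adjoint U"
    unfolding PP DE using Ec L by (simp add: unitary_conj_mult[OF U])
  finally have AU: "A = U * (E * L * E) * mat_adjoint U" .
  have x: "(E * E) $$ (i, i) = complex_of_real (Re ((E * E) $$ (i, i)))" if "i < n" for i
    using psd_diag_nonneg[OF psd_gram[OF Ec] that] psd_adjoint[OF E]
    by (simp add: less_eq_complex_def complex_eq_iff)
  have "mat_trace A = mat_trace (E * (L * E))"
    unfolding AU using Ec L mat_trace_unitary_conj[OF U, of "E * L * E"]
    by (simp add: assoc_mult_mat[of _ n n _ n _ n])
  also have "\<dots> = mat_trace (L * E * E)" by (rule mat_trace_comm[of _ n n]) (use Ec L in auto)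
  also have "\<dots> = mat_trace (L * (E * E))" using Ec L by (simp add: assoc_mult_mat[of _ n n _ n _ n])
  also have "\<dots> = (\<Sum>i<n. complex_of_real (p i * p i) * (E * E) $$ (i, i))"
    unfolding L_def using Ec by (subst dmat_mult_left[of _ n n]) (auto simp: mat_trace_def)
  finally have t: "Re (mat_trace A) = (\<Sum>i<n. p i ^ 2 * Re ((E * E) $$ (i, i)))"
    by (simp add: power2_eq_square)
  define K where "K = E * E * E"
  have K: "K \<in> carrier_mat n n" using Ec by (simp add: K_def)
  have Kadj: "mat_adjoint K = K"
    unfolding K_def using Ec by (simp add: mat_adjoint_mult[of _ n n _ n] psd_adjoint[OF E] assoc_mult_mat[of _ n n _ n _ n])
  have Ksym: "K $$ (j, i) = cnj (K $$ (i, j))" if "i < n" "j < n" for i j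
    using mat_adjoint_index[of j K i] K that unfolding Kadj by simp
  have AD: "A * D = U * (E * L * (E * E)) * mat_adjoint U"
    unfolding AU DE using Ec L by (simp add: unitary_conj_mult[OF U] assoc_mult_mat[of _ n n _ n _ n])
  have "mat_trace (A * D * (A * D)) = mat_trace (E * L * (E * E) * (E * L * (E * E)))"
    unfolding AD using Ec L by (subst unitary_conj_mult[OF U]) (auto simp: mat_trace_unitary_conj[OF U])
  also have "\<dots> = mat_trace ((E * (L * (K * L))) * (E * E))"
    unfolding K_def using Ec L by (simp add: assoc_mult_mat[of _ n n _ n _ n])
  also have "\<dots> = mat_trace ((E * E) * (E * (L * (K * L))))"
    by (rule mat_trace_comm[of _ n n]) (use Ec L K in auto)
  also have "\<dots> = mat_trace ((K * L) * (K * L))"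
    unfolding K_def using Ec L by (simp add: assoc_mult_mat[of _ n n _ n _ n])
  also have "\<dots> = (\<Sum>i<n. \<Sum>j<n. (K $$ (i, j) * complex_of_real (p j * p j)) * (K $$ (j, i) * complex_of_real (p i * p i)))"
    unfolding L_def dmat_mult_right[OF K] using K
    by (auto simp: mat_trace_def scalar_prod_def atLeast0LessThan intro!: sum.cong)
  also have "\<dots> = (\<Sum>i<n. \<Sum>j<n. complex_of_real (p i ^ 2 * p j ^ 2 * (cmod (K $$ (i, j)))\<^sup>2))"
  proof (intro sum.cong refl)
    fix i j assume "i \<in> {..<n}" "j \<in> {..<n}"
    then have "K $$ (j, i) = cnj (K $$ (i, j))" by (intro Ksym) auto
    then show "(K $$ (i, j) * complex_of_real (p j * p j)) * (K $$ (j, i) * complex_of_real (p i * p i))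
      = complex_of_real (p i ^ 2 * p j ^ 2 * (cmod (K $$ (i, j)))\<^sup>2)"
      using mult_conj_cmod_square[of "K $$ (i, j)"] by (simp add: power2_eq_square)
  qed
  finally have X: "Re (mat_trace (A * D * (A * D))) = (\<Sum>i<n. \<Sum>j<n. p i ^ 2 * p j ^ 2 * (cmod (K $$ (i, j)))\<^sup>2)"
    by simp
  have XK: "(\<Sum>i<n. p i ^ 4 * (Re (K $$ (i, i)))\<^sup>2) \<le> Re (mat_trace (A * D * (A * D)))"
    unfolding X
  proof (rule sum_mono)
    fix i assume i: "i \<in> {..<n}"
    have "(Re (K $$ (i, i)))\<^sup>2 \<le> (cmod (K $$ (i, i)))\<^sup>2"
      using power_mono[OF abs_Re_le_cmod[of "K $$ (i, i)"], of 2] by simp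
    then have "p i ^ 4 * (Re (K $$ (i, i)))\<^sup>2 \<le> p i ^ 4 * (cmod (K $$ (i, i)))\<^sup>2"
      by (intro mult_left_mono) auto
    also have "\<dots> = p i ^ 2 * p i ^ 2 * (cmod (K $$ (i, i)))\<^sup>2" by (simp flip: power_add)
    also have "\<dots> \<le> (\<Sum>j<n. p i ^ 2 * p j ^ 2 * (cmod (K $$ (i, j)))\<^sup>2)"
      by (rule member_le_sum[OF i]) auto
    finally show "p i ^ 4 * (Re (K $$ (i, i)))\<^sup>2 \<le> (\<Sum>j<n. p i ^ 2 * p j ^ 2 * (cmod (K $$ (i, j)))\<^sup>2)" .
  qed
  have F: "trace_norm (psd_sqrt A * G) = (\<Sum>i<n. p i)"
    unfolding trace_norm_eq_trace_psd_sqrt_sandwich[OF A G] P_def[symmetric]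
    unfolding PU mat_trace_unitary_conj[OF U dmat_carrier] mat_trace_dmat by simp
  have "Re (mat_trace A) ^ 3 \<le> (\<Sum>i<n. p i)\<^sup>2 * (\<Sum>i<n. p i ^ 4 * (Re (K $$ (i, i)))\<^sup>2)"
    unfolding t K_def by (rule hoelder_chain) (auto simp: p psd_diag_moment_ineq[OF E])
  also have "\<dots> \<le> (\<Sum>i<n. p i)\<^sup>2 * Re (mat_trace (A * D * (A * D)))"
    by (intro mult_left_mono XK) simp
  finally show ?thesis unfolding F .
qed

section \<open>Block diagonal matrices and classical-quantum operators\<close>

text \<open>The operator sum_k |k><k| (x) f k: an index \<open>i\<close> stands for block
  \<open>i div d\<close> and position \<open>i mod d\<close>, the convention of \<open>kron\<close>.
  It replaces tensor products by blockwise computations.\<close>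

definition bdiag :: "nat \<Rightarrow> nat \<Rightarrow> (nat \<Rightarrow> complex mat) \<Rightarrow> complex mat" where
  "bdiag N d f = mat (N * d) (N * d)
     (\<lambda>(i, j). if i div d = j div d then f (i div d) $$ (i mod d, j mod d) else 0)"

lemma bdiag_carrier[simp]: "bdiag N d f \<in> carrier_mat (N * d) (N * d)"
  by (simp add: bdiag_def)

lemma bdiag_cong: "(\<And>k. k < N \<Longrightarrow> f k = g k) \<Longrightarrow> bdiag N d f = bdiag N d g"
  unfolding bdiag_def by (intro eq_matI) (auto simp: less_mult_imp_div_less)

lemma sum_blocks:
  fixes g :: "nat \<Rightarrow> 'a :: comm_monoid_add"
  shows "(\<Sum>l<N * d. g l) = (\<Sum>k<N. \<Sum>r<d. g (k * d + r))"
proof -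
  have "(\<Sum>l<N * d. g l) = (\<Sum>k<N. sum g {k * d..<k * d + d})"
    by (rule sum.nat_group[symmetric])
  also have "\<dots> = (\<Sum>k<N. \<Sum>r<d. g (k * d + r))"
  proof (rule sum.cong[OF refl])
    fix k
    show "sum g {k * d..<k * d + d} = (\<Sum>r<d. g (k * d + r))"
      using sum.shift_bounds_nat_ivl[of g 0 "k * d" d] by (simp add: atLeast0LessThan add.commute)
  qed
  finally show ?thesis .
qed

lemma bdiag_mult:
  assumes d: "d > 0" and f: "\<And>k. k < N \<Longrightarrow> f k \<in> carrier_mat d d" and g: "\<And>k. k < N \<Longrightarrow> g k \<in> carrier_mat d d"
  shows "bdiag N d f * bdiag N d g = bdiag N d (\<lambda>k. f k * g k)"
proof (rule eq_matI)
  fix i j assume "i < dim_row (bdiag N d (\<lambda>k. f k * g k))" "j < dim_col (bdiag N d (\<lambda>k. f k * g k))"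
  then have ij: "i < N * d" "j < N * d" by (auto simp: bdiag_def)
  define a b where "a = i div d" and "b = j div d"
  have ab: "a < N" "b < N" using ij by (auto simp: a_def b_def less_mult_imp_div_less)
  have "(bdiag N d f * bdiag N d g) $$ (i, j) = (\<Sum>l<N * d. bdiag N d f $$ (i, l) * bdiag N d g $$ (l, j))"
    using ij by (auto simp: bdiag_def scalar_prod_def atLeast0LessThan intro!: sum.cong)
  also have "\<dots> = (\<Sum>l<N * d. (if a = l div d then f a $$ (i mod d, l mod d) else 0)
      * (if l div d = b then g b $$ (l mod d, j mod d) else 0))"
    using ij by (intro sum.cong refl) (auto simp: bdiag_def a_def b_def)
  also have "\<dots> = (\<Sum>k<N. \<Sum>r<d. (if a = k then f a $$ (i mod d, r) else 0) * (if k = b then g b $$ (r, j mod d) else 0))"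
    unfolding sum_blocks using d by (intro sum.cong refl) auto
  also have "\<dots> = (\<Sum>k<N. if k = a then (\<Sum>r<d. f a $$ (i mod d, r) * (if a = b then g b $$ (r, j mod d) else 0)) else 0)"
    by (intro sum.cong refl) auto
  also have "\<dots> = (\<Sum>r<d. f a $$ (i mod d, r) * (if a = b then g b $$ (r, j mod d) else 0))"
    using ab by (simp add: sum.delta)
  also have "\<dots> = bdiag N d (\<lambda>k. f k * g k) $$ (i, j)"
    using ij f[OF ab(1)] g[OF ab(1)] d
    by (auto simp: bdiag_def a_def[symmetric] b_def[symmetric] scalar_prod_def atLeast0LessThan)
  finally show "(bdiag N d f * bdiag N d g) $$ (i, j) = bdiag N d (\<lambda>k. f k * g k) $$ (i, j)" .
qed (auto simp: bdiag_def)

lemma bdiag_trace: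
  assumes d: "d > 0" and f: "\<And>k. k < N \<Longrightarrow> f k \<in> carrier_mat d d"
  shows "mat_trace (bdiag N d f) = (\<Sum>k<N. mat_trace (f k))"
proof -
  have "mat_trace (bdiag N d f) = (\<Sum>l<N * d. f (l div d) $$ (l mod d, l mod d))"
    by (simp add: mat_trace_def bdiag_def)
  also have "\<dots> = (\<Sum>k<N. \<Sum>r<d. f k $$ (r, r))"
    unfolding sum_blocks using d by (intro sum.cong refl) auto
  also have "\<dots> = (\<Sum>k<N. mat_trace (f k))"
    using f by (intro sum.cong refl) (auto simp: mat_trace_def)
  finally show ?thesis .
qed

lemma bdiag_adjoint:
  assumes d: "d > 0" and f: "\<And>k. k < N \<Longrightarrow> f k \<in> carrier_mat d d"
  shows "mat_adjoint (bdiag N d f) = bdiag N d (\<lambda>k. mat_adjoint (f k))"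
proof (rule eq_matI)
  fix i j assume "i < dim_row (bdiag N d (\<lambda>k. mat_adjoint (f k)))" "j < dim_col (bdiag N d (\<lambda>k. mat_adjoint (f k)))"
  then have ij: "i < N * d" "j < N * d" by (auto simp: bdiag_def)
  then have "f (i div d) \<in> carrier_mat d d" by (intro f) (simp add: less_mult_imp_div_less)
  then show "mat_adjoint (bdiag N d f) $$ (i, j) = bdiag N d (\<lambda>k. mat_adjoint (f k)) $$ (i, j)"
    using ij d by (auto simp: bdiag_def mat_adjoint_index)
qed (auto simp: bdiag_def)

lemma bdiag_one:
  assumes d: "d > 0" shows "bdiag N d (\<lambda>_. 1\<^sub>m d) = 1\<^sub>m (N * d)"
proof (rule eq_matI)
  fix i j assume ij: "i < dim_row (1\<^sub>m (N * d) :: complex mat)" "j < dim_col (1\<^sub>m (N * d) :: complex mat)"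
  have "i div d = j div d \<and> i mod d = j mod d \<longleftrightarrow> i = j" by (metis div_mult_mod_eq)
  then show "bdiag N d (\<lambda>_. 1\<^sub>m d) $$ (i, j) = 1\<^sub>m (N * d) $$ (i, j)"
    using ij d by (auto simp: bdiag_def)
qed (auto simp: bdiag_def)

lemma bdiag_diff:
  assumes d: "d > 0" and f: "\<And>k. k < N \<Longrightarrow> f k \<in> carrier_mat d d" and g: "\<And>k. k < N \<Longrightarrow> g k \<in> carrier_mat d d"
  shows "bdiag N d f - bdiag N d g = bdiag N d (\<lambda>k. f k - g k)"
proof (rule eq_matI)
  fix i j assume "i < dim_row (bdiag N d (\<lambda>k. f k - g k))" "j < dim_col (bdiag N d (\<lambda>k. f k - g k))"
  then have ij: "i < N * d" "j < N * d" by (auto simp: bdiag_def)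
  then have "f (i div d) \<in> carrier_mat d d" "g (i div d) \<in> carrier_mat d d"
    by (auto intro!: f g simp: less_mult_imp_div_less)
  then show "(bdiag N d f - bdiag N d g) $$ (i, j) = bdiag N d (\<lambda>k. f k - g k) $$ (i, j)"
    using ij d by (auto simp: bdiag_def)
qed (auto simp: bdiag_def)

text \<open>Blockwise square roots exhibit the matrix as a Gram matrix, so no vector has to be split
  into blocks.\<close>

lemma psd_bdiag:
  assumes d: "d > 0" and f: "\<And>k. k < N \<Longrightarrow> psd d (f k)"
  shows "psd (N * d) (bdiag N d f)"
proof -
  define R where "R k = psd_sqrt (f k)" for k
  have R: "psd d (R k)" "R k * R k = f k" if "k < N" for k
    using psd_psd_sqrt psd_sqrt_square f[OF that] by (auto simp: R_def)
  have Rc: "R k \<in> carrier_mat d d" if "k < N" for k using R(1)[OF that] by (rule psd_carrier)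
  have "mat_adjoint (bdiag N d R) * bdiag N d R = bdiag N d (\<lambda>k. mat_adjoint (R k)) * bdiag N d R"
    using bdiag_adjoint[OF d, of N R] Rc by simp
  also have "\<dots> = bdiag N d (\<lambda>k. mat_adjoint (R k) * R k)"
    using Rc by (intro bdiag_mult[OF d]) auto
  also have "\<dots> = bdiag N d f"
    by (rule bdiag_cong) (simp add: R psd_adjoint[OF R(1)])
  finally show ?thesis using psd_gram[OF bdiag_carrier[of N d R]] by simp
qed

text \<open>Compression by \<open>V\<close>, the embedding of a d-dimensional space as the k-th
  block.\<close>

lemma psd_bdiag_block:
  assumes d: "d > 0" and f: "\<And>k. k < N \<Longrightarrow> f k \<in> carrier_mat d d"
    and psd: "psd (N * d) (bdiag N d f)" and k: "k < N"
  shows "psd d (f k)"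
proof -
  define V :: "complex mat" where "V = mat (N * d) d (\<lambda>(i, j). if i = k * d + j then 1 else 0)"
  have V: "V \<in> carrier_mat (N * d) d" by (simp add: V_def)
  let ?B = "bdiag N d f"
  have lt: "k * d + j < N * d" if "j < d" for j
  proof -
    have "k * d + j < Suc k * d" using that by simp
    also have "\<dots> \<le> N * d" using k by (intro mult_le_mono1) simp
    finally show ?thesis .
  qed
  have BV: "?B * V = mat (N * d) d (\<lambda>(i, j). ?B $$ (i, k * d + j))"
  proof (rule eq_matI)
    fix i j assume "i < dim_row (mat (N * d) d (\<lambda>(i, j). ?B $$ (i, k * d + j)))"
      "j < dim_col (mat (N * d) d (\<lambda>(i, j). ?B $$ (i, k * d + j)))"
    then have ij: "i < N * d" "j < d" by auto
    have "(?B * V) $$ (i, j) = (\<Sum>l<N * d. ?B $$ (i, l) * V $$ (l, j))"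
      using ij V by (auto simp: bdiag_def scalar_prod_def atLeast0LessThan intro!: sum.cong)
    also have "\<dots> = (\<Sum>l<N * d. if l = k * d + j then ?B $$ (i, l) else 0)"
      using ij by (intro sum.cong refl) (auto simp: V_def)
    finally show "(?B * V) $$ (i, j) = mat (N * d) d (\<lambda>(i, j). ?B $$ (i, k * d + j)) $$ (i, j)"
      using ij lt by (simp add: sum.delta)
  qed (auto simp: V_def bdiag_def)
  have "mat_adjoint V * (?B * V) = f k"
  proof (rule eq_matI)
    fix i j assume "i < dim_row (f k)" "j < dim_col (f k)"
    then have ij: "i < d" "j < d" using f[OF k] by auto
    have "(mat_adjoint V * (?B * V)) $$ (i, j) = (\<Sum>l<N * d. cnj (V $$ (l, i)) * ?B $$ (l, k * d + j))"
      unfolding BV using ij V by (auto simp: scalar_prod_def atLeast0LessThan mat_adjoint_index intro!: sum.cong)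
    also have "\<dots> = (\<Sum>l<N * d. if l = k * d + i then ?B $$ (l, k * d + j) else 0)"
      using ij by (intro sum.cong refl) (auto simp: V_def)
    also have "\<dots> = f k $$ (i, j)"
      using ij lt[OF ij(1)] lt[OF ij(2)] by (simp add: sum.delta bdiag_def)
    finally show "(mat_adjoint V * (?B * V)) $$ (i, j) = f k $$ (i, j)" .
  qed (use V f[OF k] in \<open>auto simp: BV\<close>)
  moreover have "mat_adjoint V * ?B * V = mat_adjoint V * (?B * V)"
    using V by (intro assoc_mult_mat[of _ d "N * d" _ "N * d"]) auto
  ultimately show ?thesis using psd_congruence[OF psd V] by simp
qed

lemma kron_scaled_one:
  assumes "\<sigma> \<in> carrier_mat d d"
  shows "kron (c \<cdot>\<^sub>m 1\<^sub>m N) \<sigma> = bdiag N d (\<lambda>_. c \<cdot>\<^sub>m \<sigma>)"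
proof (rule eq_matI)
  fix i j assume "i < dim_row (bdiag N d (\<lambda>_. c \<cdot>\<^sub>m \<sigma>))" "j < dim_col (bdiag N d (\<lambda>_. c \<cdot>\<^sub>m \<sigma>))"
  then have ij: "i < N * d" "j < N * d" by (auto simp: bdiag_def)
  then have "d > 0" by (cases d) auto
  then have "i mod d < d" "j mod d < d" by auto
  with ij show "kron (c \<cdot>\<^sub>m 1\<^sub>m N) \<sigma> $$ (i, j) = bdiag N d (\<lambda>_. c \<cdot>\<^sub>m \<sigma>) $$ (i, j)"
    using assms by (simp add: kron_def bdiag_def less_mult_imp_div_less)
qed (use assms in \<open>auto simp: kron_def bdiag_def\<close>)

section \<open>Bit strings as block indices\<close>

lemma bits_index_horner:
  assumes "z \<in> carrier_vec n"
  shows "bits_index z = horner_sum of_bool 2 (map (\<lambda>j. z $ (n - 1 - j) = 1) [0..<n])"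
proof -
  have "horner_sum of_bool 2 (map (\<lambda>j. z $ (n - 1 - j) = 1) [0..<n])
      = (\<Sum>i<n. of_bool (z $ (n - Suc i) = 1) * 2 ^ i :: nat)"
    by (simp add: horner_sum_eq_sum atLeast0LessThan)
  also have "\<dots> = (\<Sum>i<n. of_bool (z $ (n - Suc (n - Suc i)) = 1) * 2 ^ (n - Suc i))"
    by (rule sum.nat_diff_reindex[symmetric])
  also have "\<dots> = bits_index z"
    using assms unfolding bits_index_def by (intro sum.cong) auto
  finally show ?thesis by simp
qed

text \<open>The binary digits of \<open>bits_index z\<close> are the entries of \<open>z\<close> in
  reverse order, because the first bit is the most significant one. Looking up digits therefore
  recovers the string, and the digits of \<open>k\<close> give a preimage.\<close>

lemma bij_betw_bits_index: "bij_betw bits_index (carrier_vec n) {..<2 ^ n}"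
proof (rule bij_betw_imageI)
  have bit: "bit (bits_index z) j \<longleftrightarrow> j < n \<and> z $ (n - 1 - j) = 1" if "z \<in> carrier_vec n" for z j
    unfolding bits_index_horner[OF that] bit_horner_sum_bit_iff by auto
  show "inj_on bits_index (carrier_vec n)"
  proof (rule inj_onI)
    fix x y :: "bit vec" assume x: "x \<in> carrier_vec n" and y: "y \<in> carrier_vec n" and eq: "bits_index x = bits_index y"
    show "x = y"
    proof (rule eq_vecI)
      fix i assume "i < dim_vec y"
      then have i: "n - Suc i < n" "n - 1 - (n - Suc i) = i" using y by auto
      have "x $ i = 1 \<longleftrightarrow> y $ i = 1"
        using bit[OF x, of "n - Suc i"] bit[OF y, of "n - Suc i"] i unfolding eq by simp
      then show "x $ i = y $ i" by (metis bit_not_one_iff)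
    qed (use x y in auto)
  qed
  have "bits_index z < 2 ^ n" if "z \<in> carrier_vec n" for z
    using horner_sum_of_bool_2_less[where ?'a = nat and bs = "map (\<lambda>j. z $ (n - 1 - j) = 1) [0..<n]"]
    unfolding bits_index_horner[OF that] by simp
  moreover have "k \<in> bits_index ` carrier_vec n" if "k < 2 ^ n" for k
  proof -
    define z :: "bit vec" where "z = vec n (\<lambda>i. of_bool (bit k (n - 1 - i)))"
    have z: "z \<in> carrier_vec n" by (simp add: z_def)
    have "bits_index z = horner_sum of_bool 2 (map (bit k) [0..<n])"
      unfolding bits_index_horner[OF z] by (intro arg_cong[of _ _ "horner_sum of_bool 2"] map_cong) (auto simp: z_def)
    also have "\<dots> = k" using that by (simp add: horner_sum_bit_eq_take_bit take_bit_nat_eq_self)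
    finally show ?thesis using z by (metis image_eqI)
  qed
  ultimately show "bits_index ` carrier_vec n = {..<2 ^ n}" by auto
qed

lemma finite_bit_carrier_vec[simp]: "finite (carrier_vec n :: bit vec set)"
  using bij_betw_finite[OF bij_betw_bits_index[of n]] by simp

definition index_bits :: "nat \<Rightarrow> nat \<Rightarrow> bit vec" where
  "index_bits n = inv_into (carrier_vec n) bits_index"

lemma bij_betw_index_bits: "bij_betw (index_bits n) {..<2 ^ n} (carrier_vec n)"
  unfolding index_bits_def by (rule bij_betw_inv_into[OF bij_betw_bits_index])

lemma index_bits_carrier: "k < 2 ^ n \<Longrightarrow> index_bits n k \<in> carrier_vec n"
  using bij_betwE[OF bij_betw_index_bits[of n]] by simp

lemma bits_index_index_bits: "k < 2 ^ n \<Longrightarrow> bits_index (index_bits n k) = k"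
  unfolding index_bits_def by (rule bij_betw_inv_into_right[OF bij_betw_bits_index]) simp

lemma index_bits_surj: "z \<in> carrier_vec n \<Longrightarrow> \<exists>k<2 ^ n. index_bits n k = z"
  using bij_betw_imp_surj_on[OF bij_betw_index_bits] by (metis imageE lessThan_iff)

text \<open>The projector onto the ket of \<open>z\<close> is the diagonal matrix unit at
  \<open>bits_index z\<close>, so each string fills exactly one diagonal block.\<close>

lemma cq_op_eq_bdiag:
  assumes d: "d > 0" and \<rho>: "\<forall>z \<in> carrier_vec n. \<rho> z \<in> carrier_mat d d"
  shows "cq_op n d \<rho> = bdiag (2 ^ n) d (\<lambda>k. \<rho> (index_bits n k))"
proof (rule eq_matI)
  fix i j assume "i < dim_row (bdiag (2 ^ n) d (\<lambda>k. \<rho> (index_bits n k)))"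
    "j < dim_col (bdiag (2 ^ n) d (\<lambda>k. \<rho> (index_bits n k)))"
  then have ij: "i < 2 ^ n * d" "j < 2 ^ n * d" by (auto simp: bdiag_def)
  then have ab: "i div d < 2 ^ n" "j div d < 2 ^ n" by (auto simp: less_mult_imp_div_less)
  have "cq_op n d \<rho> $$ (i, j) = (\<Sum>z\<in>carrier_vec n. kron (ket_bra (comp_ket z)) (\<rho> z) $$ (i, j))"
    using ij by (simp add: cq_op_def mat_sum_def)
  also have "\<dots> = (\<Sum>k<2 ^ n. kron (ket_bra (comp_ket (index_bits n k))) (\<rho> (index_bits n k)) $$ (i, j))"
    by (rule sum.reindex_bij_betw[OF bij_betw_index_bits, symmetric])
  also have "\<dots> = (\<Sum>k<2 ^ n. if k = i div d then if i div d = j div d then \<rho> (index_bits n k) $$ (i mod d, j mod d) else 0 else 0)"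
  proof (intro sum.cong refl)
    fix k :: nat assume "k \<in> {..<2 ^ n}"
    then have k: "k < 2 ^ n" by simp
    have c: "index_bits n k \<in> carrier_vec n" by (rule index_bits_carrier[OF k])
    have r: "\<rho> (index_bits n k) \<in> carrier_mat d d" using \<rho> c by blast
    have "comp_ket (index_bits n k) = unit_vec (2 ^ n) k"
      using c by (simp add: comp_ket_def bits_index_index_bits[OF k])
    then show "kron (ket_bra (comp_ket (index_bits n k))) (\<rho> (index_bits n k)) $$ (i, j)
      = (if k = i div d then if i div d = j div d then \<rho> (index_bits n k) $$ (i mod d, j mod d) else 0 else 0)"
      using ij ab r k by (auto simp: kron_def ket_bra_def)
  qed
  also have "\<dots> = bdiag (2 ^ n) d (\<lambda>k. \<rho> (index_bits n k)) $$ (i, j)"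
    using ij ab by (simp add: sum.delta bdiag_def)
  finally show "cq_op n d \<rho> $$ (i, j) = bdiag (2 ^ n) d (\<lambda>k. \<rho> (index_bits n k)) $$ (i, j)" .
qed (auto simp: bdiag_def cq_op_def mat_sum_def)

section \<open>Finite sums and nonnegative combinations of operators\<close>

lemma mat_sum_carrier[simp]: "mat_sum d X S \<in> carrier_mat d d"
  by (simp add: mat_sum_def)

lemma mat_sum_trace_mult:
  assumes "\<And>z. z \<in> S \<Longrightarrow> X z \<in> carrier_mat d d" "M \<in> carrier_mat d d"
  shows "mat_trace (mat_sum d X S * M) = (\<Sum>z\<in>S. mat_trace (X z * M))"
proof -
  have "mat_trace (mat_sum d X S * M) = (\<Sum>i<d. \<Sum>j<d. \<Sum>z\<in>S. X z $$ (i, j) * M $$ (j, i))"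
    using assms(2) by (auto simp: mat_trace_def mat_sum_def scalar_prod_def atLeast0LessThan sum_distrib_right intro!: sum.cong)
  also have "\<dots> = (\<Sum>i<d. \<Sum>z\<in>S. \<Sum>j<d. X z $$ (i, j) * M $$ (j, i))"
    by (intro sum.cong refl sum.swap)
  also have "\<dots> = (\<Sum>z\<in>S. \<Sum>i<d. \<Sum>j<d. X z $$ (i, j) * M $$ (j, i))" by (rule sum.swap)
  also have "\<dots> = (\<Sum>z\<in>S. mat_trace (X z * M))"
  proof (intro sum.cong refl)
    fix z assume "z \<in> S"
    then show "(\<Sum>i<d. \<Sum>j<d. X z $$ (i, j) * M $$ (j, i)) = mat_trace (X z * M)"
      using assms(1)[of z] assms(2)
      by (auto simp: mat_trace_def scalar_prod_def atLeast0LessThan intro!: sum.cong)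
  qed
  finally show ?thesis .
qed

lemma mat_sum_trace:
  assumes "\<And>z. z \<in> S \<Longrightarrow> X z \<in> carrier_mat d d"
  shows "mat_trace (mat_sum d X S) = (\<Sum>z\<in>S. mat_trace (X z))"
  using mat_sum_trace_mult[of S X d "1\<^sub>m d"] assms by simp

lemma psd_add: "psd d A \<Longrightarrow> psd d B \<Longrightarrow> psd d (A + B)"
proof -
  assume A: "psd d A" and B: "psd d B"
  have c: "A \<in> carrier_mat d d" "B \<in> carrier_mat d d" using A B by (auto simp: psd_def)
  have "0 \<le> ((A + B) *\<^sub>v v) \<bullet>c v" if v: "v \<in> carrier_vec d" for v
  proof -
    have "((A + B) *\<^sub>v v) \<bullet>c v = (A *\<^sub>v v) \<bullet>c v + (B *\<^sub>v v) \<bullet>c v"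
      using c v by (simp add: add_mult_distrib_mat_vec[of _ d d] add_scalar_prod_distrib[of _ d])
    moreover have "0 \<le> (A *\<^sub>v v) \<bullet>c v" "0 \<le> (B *\<^sub>v v) \<bullet>c v" using A B v unfolding psd_def by blast+
    ultimately show ?thesis by simp
  qed
  then show ?thesis using c by (simp add: psd_def)
qed

lemma psd_smult: "psd d A \<Longrightarrow> 0 \<le> r \<Longrightarrow> psd d (complex_of_real r \<cdot>\<^sub>m A)"
proof -
  assume A: "psd d A" and r: "0 \<le> r"
  have c: "A \<in> carrier_mat d d" using A by (auto simp: psd_def)
  have "0 \<le> ((complex_of_real r \<cdot>\<^sub>m A) *\<^sub>v v) \<bullet>c v" if v: "v \<in> carrier_vec d" for v
  proof -
    have "(complex_of_real r \<cdot>\<^sub>m A) *\<^sub>v v = complex_of_real r \<cdot>\<^sub>v (A *\<^sub>v v)"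
      using c v by (intro eq_vecI) auto
    then have "((complex_of_real r \<cdot>\<^sub>m A) *\<^sub>v v) \<bullet>c v = complex_of_real r * ((A *\<^sub>v v) \<bullet>c v)"
      using c v by simp
    moreover have "0 \<le> (A *\<^sub>v v) \<bullet>c v" using A v unfolding psd_def by blast
    ultimately show ?thesis using r by (simp add: less_eq_complex_def)
  qed
  then show ?thesis using c unfolding psd_def by (metis smult_carrier_mat)
qed

lemma psd_mat_sum:
  assumes "finite S" "\<And>z. z \<in> S \<Longrightarrow> psd d (X z)"
  shows "psd d (mat_sum d X S)"
  using assms
proof (induction S rule: finite_induct)
  case empty
  have "mat_sum d X {} = dmat d (\<lambda>_. 0)" by (intro eq_matI) (auto simp: mat_sum_def dmat_def)
  then show ?case by (simp add: psd_dmat)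
next
  case (insert z S)
  have "X z \<in> carrier_mat d d" using insert.prems psd_carrier by blast
  then have "mat_sum d X (insert z S) = X z + mat_sum d X S"
    using insert.hyps by (intro eq_matI) (auto simp: mat_sum_def)
  then show ?case using insert by (simp add: psd_add)
qed

text \<open>With \<open>S\<close> the set of all strings this is rho^z <= rho_E, which makes rho_E a
  feasible point for \<open>H_min\<close>.\<close>

lemma psd_mat_sum_diff:
  assumes "finite S" "\<And>z. z \<in> S \<Longrightarrow> psd d (X z)" "z \<in> S"
  shows "psd d (mat_sum d X S - X z)"
proof -
  have "X z \<in> carrier_mat d d" using assms psd_carrier by blast
  then have "mat_sum d X S - X z = mat_sum d X (S - {z})"
    using assms(1,3) by (intro eq_matI) (auto simp: mat_sum_def sum.remove)
  moreover have "psd d (mat_sum d X (S - {z}))" using assms by (intro psd_mat_sum) auto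
  ultimately show ?thesis by simp
qed

section \<open>Bounds on the max-entropy\<close>

lemma dmat_cong: "(\<And>i. i < n \<Longrightarrow> f i = g i) \<Longrightarrow> dmat n f = dmat n g"
  by (intro eq_matI) (simp_all add: dmat_def)

lemma unitary_conj_dmat_add:
  assumes "unitary n U"
  shows "U * dmat n f * mat_adjoint U + U * dmat n g * mat_adjoint U = U * dmat n (\<lambda>i. f i + g i) * mat_adjoint U"
proof -
  note U = unitaryD[OF assms]
  have "dmat n (\<lambda>i. f i + g i) = dmat n f + dmat n g" by (intro eq_matI) (auto simp: dmat_def)
  then have "U * dmat n (\<lambda>i. f i + g i) = U * dmat n f + U * dmat n g"
    using mult_add_distrib_mat[OF U(1) dmat_carrier dmat_carrier] by simp
  then show ?thesis
    using add_mult_distrib_mat[of "U * dmat n f" n n "U * dmat n g" "mat_adjoint U" n] U(1,2) by simp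
qed

lemma unitary_conj_dmat_const:
  assumes "unitary n U"
  shows "U * dmat n (\<lambda>_. e) * mat_adjoint U = complex_of_real e \<cdot>\<^sub>m 1\<^sub>m n"
proof -
  note U = unitaryD[OF assms]
  have "U * dmat n (\<lambda>_. e) = complex_of_real e \<cdot>\<^sub>m U"
    unfolding dmat_mult_right[OF U(1)] using U(1) by (intro eq_matI) auto
  moreover have "(complex_of_real e \<cdot>\<^sub>m U) * mat_adjoint U = complex_of_real e \<cdot>\<^sub>m (U * mat_adjoint U)"
    by (rule mult_smult_assoc_mat[OF U(1,2)])
  ultimately show ?thesis using U by simp
qed

text \<open>\<open>S\<close> and \<open>D\<close> are the square root of A + e I and its inverse.
  Everything is diagonal in an eigenbasis of \<open>A\<close>, where \<open>D * A * D\<close> has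
  the eigenvalues a / (a + e) <= 1.\<close>

lemma psd_regularised_inverse_sqrt:
  assumes A: "psd n A" and e: "e > 0"
  obtains S D where "psd n S" "psd n D" "S * S = A + complex_of_real e \<cdot>\<^sub>m 1\<^sub>m n" "S * D = 1\<^sub>m n"
    "psd n (1\<^sub>m n - D * A * D)"
proof -
  obtain U a where U: "unitary n U" and AU: "A = U * dmat n a * mat_adjoint U" and a: "\<And>i. i < n \<Longrightarrow> 0 \<le> a i"
    using psd_spectral[OF A] by blast
  have Uc: "U \<in> carrier_mat n n" using U by (simp add: unitary_def)
  define r where "r i = sqrt (a i + e)" for i
  have r: "r i > 0" "r i * r i = a i + e" if "i < n" for i
    using a[OF that] e by (auto simp: r_def)
  define S where "S = U * dmat n r * mat_adjoint U"
  define D where "D = U * dmat n (\<lambda>i. 1 / r i) * mat_adjoint U"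
  have "psd n S" unfolding S_def by (rule psd_unitary_dmat[OF U]) (simp add: r less_imp_le)
  moreover have "psd n D" unfolding D_def by (rule psd_unitary_dmat[OF U]) (simp add: r less_imp_le)
  moreover have "S * S = A + complex_of_real e \<cdot>\<^sub>m 1\<^sub>m n"
    unfolding S_def AU unitary_conj_dmat_const[OF U, symmetric] unitary_conj_dmat_add[OF U]
    by (simp add: unitary_conj_mult[OF U] dmat_mult dmat_cong[OF r(2)])
  moreover have "S * D = 1\<^sub>m n"
  proof -
    have "dmat n (\<lambda>i. r i * (1 / r i)) = dmat n (\<lambda>_. 1)"
      by (rule dmat_cong) (use r in \<open>fastforce\<close>)
    then have "S * D = U * dmat n (\<lambda>_. 1) * mat_adjoint U"
      unfolding S_def D_def by (simp only: unitary_conj_mult[OF U dmat_carrier dmat_carrier] dmat_mult)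
    then show ?thesis by (simp add: unitary_conj_dmat_const[OF U]) (intro eq_matI; simp)
  qed
  moreover have "psd n (1\<^sub>m n - D * A * D)"
  proof -
    define c where "c i = 1 / r i * a i * (1 / r i)" for i
    have DAD: "D * A * D = U * dmat n c * mat_adjoint U"
      unfolding D_def AU c_def by (simp add: unitary_conj_mult[OF U] dmat_mult)
    have "1\<^sub>m n = U * dmat n (\<lambda>i. c i + (1 - c i)) * mat_adjoint U"
      using unitary_conj_dmat_const[OF U, of 1] by simp (intro eq_matI; simp)
    also have "\<dots> = U * dmat n c * mat_adjoint U + U * dmat n (\<lambda>i. 1 - c i) * mat_adjoint U"
      by (rule unitary_conj_dmat_add[OF U, symmetric])
    finally have "1\<^sub>m n - D * A * D = U * dmat n (\<lambda>i. 1 - c i) * mat_adjoint U"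
      unfolding DAD using Uc by (intro eq_matI) auto
    moreover have "0 \<le> 1 - c i" if "i < n" for i
    proof -
      have "c i = a i / (r i * r i)" by (simp add: c_def)
      then show ?thesis using r(2)[OF that] a[OF that] e by simp
    qed
    ultimately show ?thesis using psd_unitary_dmat[OF U] by simp
  qed
  ultimately show thesis using that by blast
qed

lemma psd_trace_of_real: "psd n A \<Longrightarrow> mat_trace A = complex_of_real (Re (mat_trace A))"
  using psd_trace_nonneg[of n A] by (simp add: less_eq_complex_def complex_eq_iff)

lemma trace_cq_op:
  assumes "d > 0" "\<forall>z \<in> carrier_vec n. \<rho> z \<in> carrier_mat d d"
  shows "mat_trace (cq_op n d \<rho>) = (\<Sum>z\<in>carrier_vec n. mat_trace (\<rho> z))"
proof -
  have "mat_trace (cq_op n d \<rho>) = (\<Sum>k<2 ^ n. mat_trace (\<rho> (index_bits n k)))"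
    unfolding cq_op_eq_bdiag[OF assms] using assms index_bits_carrier by (intro bdiag_trace) auto
  also have "\<dots> = (\<Sum>z\<in>carrier_vec n. mat_trace (\<rho> z))"
    by (rule sum.reindex_bij_betw[OF bij_betw_index_bits])
  finally show ?thesis .
qed

lemma psd_cq_op:
  assumes "d > 0" "\<forall>z \<in> carrier_vec n. psd d (\<rho> z)"
  shows "psd (2 ^ n * d) (cq_op n d \<rho>)"
proof -
  have "\<forall>z \<in> carrier_vec n. \<rho> z \<in> carrier_mat d d" using assms psd_carrier by blast
  from cq_op_eq_bdiag[OF assms(1) this] show ?thesis
    using psd_bdiag[OF assms(1), of "2 ^ n" "\<lambda>k. \<rho> (index_bits n k)"] assms(2) index_bits_carrier by simp
qed

section \<open>Logarithm and exponential with infinite values\<close>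

lemma log2_mono: "x \<le> y \<Longrightarrow> log2 x \<le> log2 y"
  by (auto simp: log2_def)

lemma log2_less_top: "log2 x < \<infinity>"
  by (simp add: log2_def)

lemma exp2_nonneg: "0 \<le> exp2 x"
  by (simp add: exp2_def)

text \<open>For \<open>x > 0\<close> the first hypothesis excludes that \<open>H\<close> is minus
  infinity and the second that it is infinity, so \<open>exp2\<close> is evaluated away from its
  default value. For \<open>x \<le> 0\<close> its nonnegativity is enough.\<close>

lemma exp2_shift_ge:
  assumes "log2 (2 ^ m * x) \<le> H" "H < \<infinity>"
  shows "x \<le> exp2 (H - ereal (real m))"
proof (cases "x \<le> 0")
  case True
  then show ?thesis using exp2_nonneg order_trans by blast
next
  case False
  then have pos: "0 < 2 ^ m * x" by simp
  have "ereal (log 2 (2 ^ m * x)) \<le> H" using assms(1) by (simp only: log2_def if_not_P[OF pos[unfolded not_le[symmetric]]])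
  then obtain h where h: "H = ereal h" "log 2 (2 ^ m * x) \<le> h" using assms(2) by (cases H) auto
  then have "2 ^ m * x \<le> 2 powr h" using pos by (simp add: log_le_iff)
  then have "x \<le> 2 powr h / 2 ^ m" by (simp add: field_simps)
  then show ?thesis by (simp add: exp2_def h(1) powr_diff powr_realpow)
qed

text \<open>Since \<open>exp2 \<infinity> = 0\<close>, the lower bound also needs the supremum in \<open>H_max\<close> to be finite.\<close>

lemma trace_norm_le_exp2_H_max:
  assumes d: "d > 0" and A: "psd (2 ^ m * d) A" and \<tau>: "normalized_state d \<tau>"
  shows "(trace_norm (psd_sqrt A * psd_sqrt (kron (complex_of_real (2 powr - real m) \<cdot>\<^sub>m 1\<^sub>m (2 ^ m)) \<tau>)))\<^sup>2
    \<le> exp2 (H_max m d A - ereal (real m))"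
proof -
  define N where "N = 2 ^ m * d"
  define K where "K \<sigma> = kron (complex_of_real (2 powr - real m) \<cdot>\<^sub>m 1\<^sub>m (2 ^ m)) \<sigma>" for \<sigma>
  define val where "val \<sigma> = (trace_norm (psd_sqrt A * psd_sqrt (K \<sigma>)))\<^sup>2" for \<sigma>
  \<comment> \<open>The bound does not depend on \<sigma> because 2^(-m) I (x) \<sigma> always has
    trace 1.\<close>
  have bound: "val \<sigma> \<le> real N * Re (mat_trace A)" if \<sigma>: "normalized_state d \<sigma>" for \<sigma>
  proof -
    have ps: "psd d \<sigma>" "mat_trace \<sigma> = 1" using \<sigma> by (auto simp: normalized_state_def)
    have K: "K \<sigma> = bdiag (2 ^ m) d (\<lambda>_. complex_of_real (2 powr - real m) \<cdot>\<^sub>m \<sigma>)"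
      unfolding K_def by (rule kron_scaled_one[OF psd_carrier[OF ps(1)]])
    have pK: "psd N (K \<sigma>)"
      unfolding K N_def by (intro psd_bdiag[OF d] psd_smult[OF ps(1)]) simp
    have "mat_trace (K \<sigma>) = (\<Sum>k<2 ^ m :: nat. mat_trace (complex_of_real (2 powr - real m) \<cdot>\<^sub>m \<sigma>))"
      unfolding K using psd_carrier[OF ps(1)] by (intro bdiag_trace[OF d]) auto
    also have "\<dots> = complex_of_real (2 ^ m * 2 powr - real m)"
      by (simp add: mat_trace_smult[OF psd_carrier[OF ps(1)]] ps(2))
    also have "2 ^ m * 2 powr - real m = (1 :: real)" by (simp add: powr_minus powr_realpow)
    finally have tK: "Re (mat_trace (K \<sigma>)) = 1" by simp
    show ?thesis
      using trace_norm_upper_bound[OF A[folded N_def] psd_psd_sqrt[OF pK]]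
      by (simp add: val_def psd_sqrt_square[OF pK] tK)
  qed
  have H: "H_max m d A = (SUP \<sigma> \<in> {\<sigma>. normalized_state d \<sigma>}. log2 (2 ^ m * val \<sigma>))"
    by (simp add: H_max_def val_def K_def)
  have "log2 (2 ^ m * val \<tau>) \<le> H_max m d A"
    unfolding H by (rule SUP_upper) (simp add: \<tau>)
  moreover have "H_max m d A \<le> log2 (2 ^ m * (real N * Re (mat_trace A)))"
    unfolding H by (rule SUP_least) (auto intro!: log2_mono mult_left_mono bound)
  then have "H_max m d A < \<infinity>" using log2_less_top le_less_trans by blast
  ultimately have "val \<tau> \<le> exp2 (H_max m d A - ereal (real m))" by (rule exp2_shift_ge)
  then show ?thesis by (simp add: val_def K_def)
qed

lemma smult_smult_mat: "x \<cdot>\<^sub>m (y \<cdot>\<^sub>m A) = (x * y :: complex) \<cdot>\<^sub>m A"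
  by (intro eq_matI) auto

text \<open>\<open>S\<close> and \<open>D\<close> play the roles of B^(1/2) and B^(-1/2). They are
  fixed independently of the family \<omega>, so one pair can be used for all hash
  functions.\<close>

lemma trace_cubed_le_exp2_H_max_collision:
  assumes d: "d > 0" and \<omega>: "\<forall>k \<in> carrier_vec m. psd d (\<omega> k)"
    and S: "psd d S" and D: "psd d D" and SD: "S * D = 1\<^sub>m d"
    and b: "b = Re (mat_trace (S * S))" "b > 0"
  shows "(\<Sum>k\<in>carrier_vec m. Re (mat_trace (\<omega> k))) ^ 3 \<le> exp2 (H_max m d (cq_op m d \<omega>) - ereal (real m))
    * (b * 2 ^ m * (\<Sum>k\<in>carrier_vec m. Re (mat_trace (\<omega> k * D * (\<omega> k * D)))))"
proof -
  let ?A = "cq_op m d \<omega>" and ?N = "2 ^ m * d"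
  have \<omega>c: "\<forall>k \<in> carrier_vec m. \<omega> k \<in> carrier_mat d d" using \<omega> psd_carrier by blast
  have \<omega>i: "\<omega> (index_bits m k) \<in> carrier_mat d d" if "k < 2 ^ m" for k
    using \<omega>c index_bits_carrier[OF that] by blast
  have A: "psd ?N ?A" by (rule psd_cq_op[OF d \<omega>])
  have c: "S \<in> carrier_mat d d" "D \<in> carrier_mat d d" using S D psd_carrier by auto
  have SS: "psd d (S * S)" using psd_gram[OF c(1)] psd_adjoint[OF S] by simp
  define \<tau> where "\<tau> = complex_of_real (1 / b) \<cdot>\<^sub>m (S * S)"
  have \<tau>c: "\<tau> \<in> carrier_mat d d" using c by (simp add: \<tau>_def)
  have "mat_trace \<tau> = complex_of_real (1 / b) * complex_of_real b"
    unfolding \<tau>_def using c psd_trace_of_real[OF SS] b(1) by (simp add: mat_trace_smult[of _ d])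
  then have "mat_trace \<tau> = 1" using b(2) by (simp flip: of_real_mult)
  moreover have "psd d \<tau>" unfolding \<tau>_def using b(2) by (intro psd_smult[OF SS]) simp
  ultimately have \<tau>: "normalized_state d \<tau>" by (simp add: normalized_state_def)
  \<comment> \<open>Chosen so that the square of \<open>s\<close> times \<open>S\<close> is 2^(-m)
    \<tau>. Then \<open>G\<close> is the root of 2^(-m) I (x) \<tau>, and its inverse
    \<open>E\<close>, which occurs twice in the collision term, contributes 1 / s^2 = b 2^m.\<close>
  define s where "s = sqrt (2 powr - real m / b)"
  have s: "s > 0" "s * s = 2 powr - real m / b" using b(2) by (auto simp: s_def)
  define G where "G = bdiag (2 ^ m) d (\<lambda>_. complex_of_real s \<cdot>\<^sub>m S)"
  define E where "E = bdiag (2 ^ m) d (\<lambda>_. complex_of_real (1 / s) \<cdot>\<^sub>m D)"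
  have G: "psd ?N G" unfolding G_def using s by (intro psd_bdiag[OF d] psd_smult[OF S]) simp
  have E: "psd ?N E" unfolding E_def using s by (intro psd_bdiag[OF d] psd_smult[OF D]) simp
  have smult_mult: "(x \<cdot>\<^sub>m X) * (y \<cdot>\<^sub>m Y) = (x * y) \<cdot>\<^sub>m (X * Y)"
    if "X \<in> carrier_mat d d" "Y \<in> carrier_mat d d" for x y :: complex and X Y
    using that by (simp add: mult_smult_assoc_mat[of _ d d _ d] mult_smult_distrib[of _ d d _ d] smult_smult_mat mult.commute)
  have "G * G = bdiag (2 ^ m) d (\<lambda>_. (complex_of_real s \<cdot>\<^sub>m S) * (complex_of_real s \<cdot>\<^sub>m S))"
    unfolding G_def using c by (intro bdiag_mult[OF d]) auto
  also have "(complex_of_real s \<cdot>\<^sub>m S) * (complex_of_real s \<cdot>\<^sub>m S) = complex_of_real (2 powr - real m) \<cdot>\<^sub>m \<tau>"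
    unfolding smult_mult[OF c(1) c(1)] \<tau>_def using s(2)
    by (simp add: smult_smult_mat flip: of_real_mult)
  also have "bdiag (2 ^ m) d (\<lambda>_. complex_of_real (2 powr - real m) \<cdot>\<^sub>m \<tau>)
      = kron (complex_of_real (2 powr - real m) \<cdot>\<^sub>m 1\<^sub>m (2 ^ m)) \<tau>"
    by (rule kron_scaled_one[OF \<tau>c, symmetric])
  finally have sqrtK: "psd_sqrt (kron (complex_of_real (2 powr - real m) \<cdot>\<^sub>m 1\<^sub>m (2 ^ m)) \<tau>) = G"
    by (rule psd_sqrt_eq[OF G])
  have "G * E = bdiag (2 ^ m) d (\<lambda>_. (complex_of_real s \<cdot>\<^sub>m S) * (complex_of_real (1 / s) \<cdot>\<^sub>m D))"
    unfolding G_def E_def using c by (intro bdiag_mult[OF d]) auto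
  also have "(complex_of_real s \<cdot>\<^sub>m S) * (complex_of_real (1 / s) \<cdot>\<^sub>m D) = 1\<^sub>m d"
    unfolding smult_mult[OF c] SD using s(1) by (intro eq_matI) (auto simp flip: of_real_mult)
  finally have GE: "G * E = 1\<^sub>m ?N" by (simp add: bdiag_one[OF d])
  have AE: "?A * E = bdiag (2 ^ m) d (\<lambda>k. complex_of_real (1 / s) \<cdot>\<^sub>m (\<omega> (index_bits m k) * D))"
  proof -
    have "?A * E = bdiag (2 ^ m) d (\<lambda>k. \<omega> (index_bits m k) * (complex_of_real (1 / s) \<cdot>\<^sub>m D))"
      unfolding cq_op_eq_bdiag[OF d \<omega>c] E_def using c \<omega>i by (intro bdiag_mult[OF d]) auto
    also have "\<dots> = bdiag (2 ^ m) d (\<lambda>k. complex_of_real (1 / s) \<cdot>\<^sub>m (\<omega> (index_bits m k) * D))"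
      using c \<omega>i by (intro bdiag_cong mult_smult_distrib) auto
    finally show ?thesis .
  qed
  have "?A * E * (?A * E) = bdiag (2 ^ m) d (\<lambda>k. (complex_of_real (1 / s) \<cdot>\<^sub>m (\<omega> (index_bits m k) * D))
      * (complex_of_real (1 / s) \<cdot>\<^sub>m (\<omega> (index_bits m k) * D)))"
    unfolding AE using c \<omega>i by (intro bdiag_mult[OF d]) auto
  also have "\<dots> = bdiag (2 ^ m) d (\<lambda>k. complex_of_real (1 / s * (1 / s)) \<cdot>\<^sub>m
      (\<omega> (index_bits m k) * D * (\<omega> (index_bits m k) * D)))"
    using c \<omega>i by (intro bdiag_cong) (simp only: smult_mult[OF square_mult_carrier square_mult_carrier] of_real_mult)
  finally have "mat_trace (?A * E * (?A * E)) = (\<Sum>k<2 ^ m. complex_of_real (1 / s * (1 / s)) *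
      mat_trace (\<omega> (index_bits m k) * D * (\<omega> (index_bits m k) * D)))"
    using c \<omega>i by (simp add: bdiag_trace[OF d] mat_trace_smult[of _ d])
  also have "\<dots> = (\<Sum>k\<in>carrier_vec m. complex_of_real (1 / s * (1 / s)) * mat_trace (\<omega> k * D * (\<omega> k * D)))"
    by (rule sum.reindex_bij_betw[OF bij_betw_index_bits])
  finally have "Re (mat_trace (?A * E * (?A * E))) = 1 / s * (1 / s) * (\<Sum>k\<in>carrier_vec m. Re (mat_trace (\<omega> k * D * (\<omega> k * D))))"
    by (simp add: sum_distrib_left del: of_real_mult of_real_divide)
  also have "1 / s * (1 / s) = 1 / (2 powr - real m / b)" unfolding s(2)[symmetric] by simp
  also have "\<dots> = b * 2 ^ m" using b(2) by (simp add: powr_minus powr_realpow field_simps)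
  finally have X: "Re (mat_trace (?A * E * (?A * E))) = b * 2 ^ m * (\<Sum>k\<in>carrier_vec m. Re (mat_trace (\<omega> k * D * (\<omega> k * D))))" .
  \<comment> \<open>Nonnegativity lets the squared trace norm be replaced by its upper bound in the
    product below.\<close>
  have X0: "0 \<le> b * 2 ^ m * (\<Sum>k\<in>carrier_vec m. Re (mat_trace (\<omega> k * D * (\<omega> k * D))))"
  proof (intro mult_nonneg_nonneg sum_nonneg)
    fix k :: "bit vec" assume k: "k \<in> carrier_vec m"
    have "\<omega> k * D * (\<omega> k * D) = \<omega> k * (D * \<omega> k * D)"
      using c \<omega>c k by (simp add: assoc_mult_mat[of _ d d _ d _ d])
    then show "0 \<le> Re (mat_trace (\<omega> k * D * (\<omega> k * D)))"
      using psd_trace_mult_nonneg[of d "\<omega> k" "D * \<omega> k * D"] psd_sandwich[of d "\<omega> k" D] \<omega> k D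
      by (simp add: less_eq_complex_def)
  qed (use b in auto)
  have "(\<Sum>k\<in>carrier_vec m. Re (mat_trace (\<omega> k))) ^ 3 = Re (mat_trace ?A) ^ 3"
    by (simp add: trace_cq_op[OF d \<omega>c])
  also have "\<dots> \<le> (trace_norm (psd_sqrt ?A * G))\<^sup>2 * Re (mat_trace (?A * E * (?A * E)))"
    by (rule trace_cubed_le_trace_norm_collision[OF A G E GE])
  also have "\<dots> \<le> exp2 (H_max m d ?A - ereal (real m)) * Re (mat_trace (?A * E * (?A * E)))"
    using trace_norm_le_exp2_H_max[OF d A \<tau>] X0 unfolding sqrtK X by (intro mult_right_mono)
  finally show ?thesis unfolding X .
qed

section \<open>Averaging over the hash function\<close>

text \<open>Cyclicity makes Tr(X D Y D) a symmetric bilinear form, so sums can be expanded in either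
  argument.\<close>

lemma trace_sandwich_swap:
  assumes "X \<in> carrier_mat d d" "Y \<in> carrier_mat d d" "D \<in> carrier_mat d d"
  shows "mat_trace (X * (D * (Y * D))) = mat_trace (Y * (D * (X * D)))"
proof -
  have "mat_trace (X * (D * (Y * D))) = mat_trace ((X * D) * (Y * D))"
    using assms by (simp add: assoc_mult_mat[of _ d d _ d _ d])
  also have "\<dots> = mat_trace ((Y * D) * (X * D))"
    by (rule mat_trace_comm[of _ d d]) (use assms in auto)
  also have "\<dots> = mat_trace (Y * (D * (X * D)))"
    using assms by (simp add: assoc_mult_mat[of _ d d _ d _ d])
  finally show ?thesis .
qed

lemma collision_mat_sum:
  assumes X: "\<And>z. z \<in> S \<Longrightarrow> X z \<in> carrier_mat d d" and D: "D \<in> carrier_mat d d"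
  shows "mat_trace (mat_sum d X S * D * (mat_sum d X S * D))
    = (\<Sum>z\<in>S. \<Sum>w\<in>S. mat_trace (X z * (D * (X w * D))))"
proof -
  let ?M = "mat_sum d X S"
  have "mat_trace (?M * D * (?M * D)) = mat_trace (?M * (D * (?M * D)))"
    using D by (simp add: assoc_mult_mat[of _ d d _ d _ d])
  also have "\<dots> = (\<Sum>z\<in>S. mat_trace (X z * (D * (?M * D))))"
    using X D by (intro mat_sum_trace_mult) auto
  also have "\<dots> = (\<Sum>z\<in>S. \<Sum>w\<in>S. mat_trace (X z * (D * (X w * D))))"
  proof (rule sum.cong[OF refl])
    fix z assume z: "z \<in> S"
    have "mat_trace (X z * (D * (?M * D))) = mat_trace (?M * (D * (X z * D)))"
      using X[OF z] D by (intro trace_sandwich_swap) auto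
    also have "\<dots> = (\<Sum>w\<in>S. mat_trace (X w * (D * (X z * D))))"
      using X z D by (intro mat_sum_trace_mult) auto
    also have "\<dots> = (\<Sum>w\<in>S. mat_trace (X z * (D * (X w * D))))"
      using X z D by (intro sum.cong refl trace_sandwich_swap) auto
    finally show "mat_trace (X z * (D * (?M * D))) = (\<Sum>w\<in>S. mat_trace (X z * (D * (X w * D))))" .
  qed
  finally show ?thesis .
qed

text \<open>Two strings lie in a common fibre exactly when they collide. This moves the dependence
  on \<open>f\<close> from the blocks of the hashed state into an indicator.\<close>

lemma sum_fibres:
  fixes h :: "'a \<Rightarrow> 'a \<Rightarrow> real"
  assumes "finite S" "finite T" "f ` S \<subseteq> T"
  shows "(\<Sum>k\<in>T. \<Sum>z\<in>{z\<in>S. f z = k}. \<Sum>w\<in>{z\<in>S. f z = k}. h z w)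
    = (\<Sum>z\<in>S. \<Sum>w\<in>S. of_bool (f z = f w) * h z w)"
proof -
  have "(\<Sum>k\<in>T. \<Sum>z\<in>{z\<in>S. f z = k}. \<Sum>w\<in>{z\<in>S. f z = k}. h z w)
      = (\<Sum>k\<in>T. \<Sum>z\<in>{z\<in>S. f z = k}. \<Sum>w\<in>S. of_bool (f z = f w) * h z w)"
  proof (rule sum.cong[OF refl], rule sum.cong[OF refl])
    fix k z assume "z \<in> {z\<in>S. f z = k}"
    then have "f z = k" by simp
    then show "(\<Sum>w\<in>{z\<in>S. f z = k}. h z w) = (\<Sum>w\<in>S. of_bool (f z = f w) * h z w)"
      using assms(1) by (intro sum.mono_neutral_cong_left) auto
  qed
  also have "\<dots> = (\<Sum>z\<in>S. \<Sum>w\<in>S. of_bool (f z = f w) * h z w)"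
    by (rule sum.group[OF assms])
  finally show ?thesis .
qed

text \<open>Over the two-element field a vector is its own negative, so \<open>x + y\<close> acts as
  the difference.\<close>

lemma bit_vec_add_eq_zero_iff:
  fixes x y :: "bit vec"
  assumes "x \<in> carrier_vec n" "y \<in> carrier_vec n"
  shows "x + y = 0\<^sub>v n \<longleftrightarrow> x = y"
proof -
  have bit: "a + b = 0 \<longleftrightarrow> a = b" for a b :: bit by (cases a; cases b) auto
  have "x + y = 0\<^sub>v n \<longleftrightarrow> (\<forall>i<n. x $ i + y $ i = 0)"
    using assms by (auto simp: vec_eq_iff)
  also have "\<dots> \<longleftrightarrow> x = y" unfolding bit using assms by (auto simp: vec_eq_iff)
  finally show ?thesis .
qed

lemma f2_linear_eq_iff:
  assumes "f2_linear n m f" "x \<in> carrier_vec n" "y \<in> carrier_vec n"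
  shows "f x = f y \<longleftrightarrow> f (x + y) = 0\<^sub>v m"
  using assms bit_vec_add_eq_zero_iff[of "f x" m "f y"] by (auto simp: f2_linear_def)

text \<open>Universality speaks of zeros; linearity turns a collision of two distinct strings into a
  zero at their nonzero sum.\<close>

lemma sum_pmf_collision:
  assumes F: "linear_random_function n m F" and u: "almost_universal2 n m \<delta> F"
    and xy: "x \<in> carrier_vec n" "y \<in> carrier_vec n" "x \<noteq> y"
  shows "(\<Sum>f\<in>set_pmf F. pmf F f * of_bool (f x = f y)) \<le> 2 powr - real m * \<delta>"
proof -
  have fin: "finite (set_pmf F)" using F by (simp add: linear_random_function_def)
  have lin: "f2_linear n m f" if "f \<in> set_pmf F" for f using F that by (simp add: linear_random_function_def)
  have "(\<Sum>f\<in>set_pmf F. pmf F f * of_bool (f x = f y)) = (\<Sum>f\<in>{f. f (x + y) = 0\<^sub>v m} \<inter> set_pmf F. pmf F f)"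
    using fin f2_linear_eq_iff[OF lin xy(1,2)] by (intro sum.mono_neutral_cong_right) auto
  also have "\<dots> = measure_pmf.prob F ({f. f (x + y) = 0\<^sub>v m} \<inter> set_pmf F)"
    using fin by (intro measure_measure_pmf_finite[symmetric]) auto
  also have "\<dots> = measure_pmf.prob F {f. f (x + y) = 0\<^sub>v m}"
    by (rule measure_Int_set_pmf)
  also have "\<dots> \<le> 2 powr - real m * \<delta>"
    using u xy bit_vec_add_eq_zero_iff[OF xy(1,2)] by (auto simp: almost_universal2_def)
  finally show ?thesis .
qed

text \<open>For n >= 1 a nonzero string exists, and the probability at it is nonnegative. The sign
  matters because \<delta> is an arbitrary real that later multiplies inequalities.\<close>

lemma almost_universal2_nonneg:
  assumes "almost_universal2 n m \<delta> F" "n \<ge> 1" shows "0 \<le> \<delta>"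
proof -
  have "(unit_vec n 0 :: bit vec) \<noteq> 0\<^sub>v n"
    using assms(2) by (auto simp: vec_eq_iff intro!: exI[of _ 0])
  then have "measure_pmf.prob F {f. f (unit_vec n 0) = 0\<^sub>v m} \<le> 2 powr (- real m) * \<delta>"
    using assms(1) unfolding almost_universal2_def by auto
  then have "0 \<le> 2 powr (- real m) * \<delta>" using measure_nonneg order_trans by blast
  then show ?thesis by (simp add: zero_le_mult_iff)
qed

lemma expectation_finite_pmf:
  fixes h :: "'a \<Rightarrow> real"
  assumes "finite (set_pmf F)"
  shows "measure_pmf.expectation F h = (\<Sum>f\<in>set_pmf F. pmf F f * h f)"
  using integral_measure_pmf_real[OF assms, of F h] by (simp add: mult.commute)

text \<open>Equal strings collide with probability 1, distinct ones with probability at most 2^(-m)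
  \<delta>. Since \<delta> is nonnegative, [z = w] + 2^(-m) \<delta> bounds both cases, and its
  second part can be summed over all pairs, where \<open>total\<close> applies.\<close>

lemma expected_collision_bound:
  fixes g :: "bit vec \<Rightarrow> bit vec \<Rightarrow> real"
  assumes F: "linear_random_function n m F" and u: "almost_universal2 n m \<delta> F" and n: "n \<ge> 1"
    and g: "\<And>z w. z \<in> carrier_vec n \<Longrightarrow> w \<in> carrier_vec n \<Longrightarrow> 0 \<le> g z w"
    and diag: "(\<Sum>z\<in>carrier_vec n. g z z) \<le> s"
    and total: "(\<Sum>z\<in>carrier_vec n. \<Sum>w\<in>carrier_vec n. g z w) \<le> t"
  shows "(\<Sum>f\<in>set_pmf F. pmf F f * (2 ^ m * (\<Sum>z\<in>carrier_vec n. \<Sum>w\<in>carrier_vec n. of_bool (f z = f w) * g z w)))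
    \<le> 2 ^ m * s + \<delta> * t"
proof -
  let ?C = "carrier_vec n :: bit vec set"
  let ?q = "2 powr - real m :: real"
  have fin: "finite (set_pmf F)" using F by (simp add: linear_random_function_def)
  have \<delta>: "0 \<le> \<delta>" by (rule almost_universal2_nonneg[OF u n])
  have "(\<Sum>f\<in>set_pmf F. pmf F f * (2 ^ m * (\<Sum>z\<in>?C. \<Sum>w\<in>?C. of_bool (f z = f w) * g z w)))
      = 2 ^ m * (\<Sum>f\<in>set_pmf F. \<Sum>z\<in>?C. \<Sum>w\<in>?C. pmf F f * of_bool (f z = f w) * g z w)"
    by (simp only: sum_distrib_left mult_ac)
  also have "(\<Sum>f\<in>set_pmf F. \<Sum>z\<in>?C. \<Sum>w\<in>?C. pmf F f * of_bool (f z = f w) * g z w)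
      = (\<Sum>z\<in>?C. \<Sum>f\<in>set_pmf F. \<Sum>w\<in>?C. pmf F f * of_bool (f z = f w) * g z w)"
    by (rule sum.swap)
  also have "\<dots> = (\<Sum>z\<in>?C. \<Sum>w\<in>?C. (\<Sum>f\<in>set_pmf F. pmf F f * of_bool (f z = f w)) * g z w)"
    unfolding sum_distrib_right by (intro sum.cong refl sum.swap)
  also have "\<dots> \<le> (\<Sum>z\<in>?C. \<Sum>w\<in>?C. of_bool (z = w) * g z w + ?q * \<delta> * g z w)"
  proof (intro sum_mono)
    fix z w :: "bit vec" assume zw: "z \<in> ?C" "w \<in> ?C"
    have "(\<Sum>f\<in>set_pmf F. pmf F f * of_bool (f z = f w)) \<le> of_bool (z = w) + ?q * \<delta>"
    proof (cases "z = w")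
      case True
      then show ?thesis using sum_pmf_eq_1[OF fin order_refl] \<delta> by simp
    next
      case False
      then show ?thesis using sum_pmf_collision[OF F u zw] by simp
    qed
    from mult_right_mono[OF this g[OF zw]]
    show "(\<Sum>f\<in>set_pmf F. pmf F f * of_bool (f z = f w)) * g z w \<le> of_bool (z = w) * g z w + ?q * \<delta> * g z w"
      by (simp only: distrib_right)
  qed
  also have "\<dots> = (\<Sum>z\<in>?C. g z z) + ?q * \<delta> * (\<Sum>z\<in>?C. \<Sum>w\<in>?C. g z w)"
  proof -
    have "(\<Sum>w\<in>?C. of_bool (z = w) * g z w) = g z z" if "z \<in> ?C" for z
    proof -
      have "(\<Sum>w\<in>?C. of_bool (z = w) * g z w) = (\<Sum>w\<in>?C. if z = w then g z w else 0)"
        by (intro sum.cong refl) auto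
      then show ?thesis using that by (simp add: sum.delta')
    qed
    then show ?thesis by (simp add: sum.distrib sum_distrib_left)
  qed
  also have "\<dots> \<le> s + ?q * \<delta> * t"
    using diag total \<delta> by (intro add_mono mult_left_mono) auto
  finally have "(\<Sum>f\<in>set_pmf F. pmf F f * (2 ^ m * (\<Sum>z\<in>?C. \<Sum>w\<in>?C. of_bool (f z = f w) * g z w)))
      \<le> 2 ^ m * (s + ?q * \<delta> * t)" by simp
  also have "\<dots> = 2 ^ m * s + \<delta> * t" by (simp add: distrib_left powr_minus powr_realpow)
  finally show ?thesis .
qed

text \<open>The cubic hypothesis forces c > 0 because its left side is positive. Then (t - c)^2 >= 0
  reads 2 t - c <= t^2 / c.\<close>

lemma linear_lower_bound_of_cubic:
  fixes t v b c :: real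
  assumes "t > 0" "b > 0" "0 \<le> v" "t ^ 3 \<le> v * (b * c)"
  shows "t / b * (2 * t - c) \<le> v"
proof -
  have "0 < v * (b * c)" using assms(1,4) by (smt (verit) zero_less_power)
  then have c: "c > 0" using assms(2,3) by (simp add: zero_less_mult_iff)
  have "(2 * t - c) * c \<le> t\<^sup>2" using zero_le_power2[of "t - c"] by (simp add: power2_eq_square algebra_simps)
  then have "t * ((2 * t - c) * c) \<le> t * t\<^sup>2" using assms(1) by (intro mult_left_mono) auto
  also have "\<dots> \<le> v * (b * c)" using assms(4) by (simp add: power2_eq_square power3_eq_cube)
  finally have "(t * (2 * t - c)) * c \<le> (v * b) * c" by (simp add: ac_simps)
  then have "t * (2 * t - c) \<le> v * b" using c by (rule mult_right_le_imp_le)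
  then show ?thesis using assms(2) by (simp add: field_simps)
qed

lemma two_power_Inf_le_exp2_H_min:
  fixes n d m :: nat and \<rho> :: "complex mat" and x :: real
  defines "Feas \<equiv> {\<sigma>. psd d \<sigma> \<and> loewner_le (2 ^ n * d) \<rho> (kron (1\<^sub>m (2 ^ n)) \<sigma>)}"
  assumes "\<sigma>0 \<in> Feas" and "\<And>\<sigma>. \<sigma> \<in> Feas \<Longrightarrow> x \<le> 2 ^ m * Re (mat_trace \<sigma>)"
  shows "x \<le> exp2 (ereal (real m) - H_min n d \<rho>)"
proof -
  define I where "I = (INF \<sigma> \<in> Feas. Re (mat_trace \<sigma>))"
  have I0: "0 \<le> I" unfolding I_def
    by (rule cINF_greatest) (use assms(2) psd_trace_nonneg in \<open>auto simp: Feas_def less_eq_complex_def\<close>)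
  have "x / 2 ^ m \<le> I" unfolding I_def
    by (rule cINF_greatest) (use assms(2,3) in \<open>auto simp: field_simps\<close>)
  then have x: "x \<le> 2 ^ m * I" by (simp add: field_simps)
  have H: "H_min n d \<rho> = - log2 I" by (simp add: H_min_def I_def Feas_def)
  have "2 ^ m * I \<le> exp2 (ereal (real m) - H_min n d \<rho>)"
  proof (cases "I = 0")
    case True
    then show ?thesis using exp2_nonneg by simp
  next
    case False
    then have "I > 0" using I0 by simp
    then show ?thesis unfolding H by (simp add: log2_def exp2_def powr_add powr_realpow)
  qed
  with x show ?thesis by linarith
qed

text \<open>Here \<open>t + e * real d\<close> is the trace of rho_E + e I. At \<open>e = 0\<close>
  the right side would be (\<delta> - 1) t + 2^m Tr \<sigma>.\<close>

lemma expected_Q_PA_bound: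
  assumes n: "n \<ge> 1" and F: "linear_random_function n m F" and u: "almost_universal2 n m \<delta> F"
    and d: "d > 0" and \<rho>: "\<forall>z \<in> carrier_vec n. psd d (\<rho> z)"
    and \<sigma>: "psd d \<sigma>" "\<forall>z \<in> carrier_vec n. psd d (\<sigma> - \<rho> z)"
    and t: "t = Re (mat_trace (cq_op n d \<rho>))" "t > 0" and e: "e > 0"
  shows "measure_pmf.expectation F (\<lambda>f. Q_PA n m d f \<rho>)
    \<le> t - t / (t + e * real d) * (2 * t - (2 ^ m * Re (mat_trace \<sigma>) + \<delta> * t))"
proof -
  let ?C = "carrier_vec n :: bit vec set"
  have fin: "finite (set_pmf F)" using F by (simp add: linear_random_function_def)
  have \<rho>c: "\<rho> z \<in> carrier_mat d d" if "z \<in> ?C" for z using \<rho> that psd_carrier by blast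
  have \<sigma>c: "\<sigma> \<in> carrier_mat d d" using \<sigma> psd_carrier by blast
  define R where "R = mat_sum d \<rho> ?C"
  have R: "psd d R" unfolding R_def using \<rho> by (intro psd_mat_sum) auto
  have Rc: "R \<in> carrier_mat d d" using R by (rule psd_carrier)
  obtain S D where S: "psd d S" and D: "psd d D" and SS: "S * S = R + complex_of_real e \<cdot>\<^sub>m 1\<^sub>m d"
    and SD: "S * D = 1\<^sub>m d" and DRD: "psd d (1\<^sub>m d - D * R * D)"
    using psd_regularised_inverse_sqrt[OF R e] by blast
  have Dc: "D \<in> carrier_mat d d" using D by (rule psd_carrier)
  have trR: "Re (mat_trace R) = t"
    unfolding R_def t(1) using \<rho>c by (simp add: trace_cq_op[OF d] mat_sum_trace)
  define b where "b = t + e * real d"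
  have b: "b > 0" using t(2) e by (simp add: b_def add_pos_nonneg)
  have "mat_trace (1\<^sub>m d) = of_nat d" by (simp add: mat_trace_def)
  then have trSS: "b = Re (mat_trace (S * S))"
    unfolding SS b_def using Rc by (simp add: mat_trace_add[of _ d] mat_trace_smult[of _ d] trR)
  define g where "g z w = Re (mat_trace (\<rho> z * (D * (\<rho> w * D))))" for z w
  have sandwich: "psd d (D * (X * D))" if "psd d X" for X
    using psd_sandwich[OF that D] Dc psd_carrier[OF that] by (simp add: assoc_mult_mat[of _ d d _ d _ d])
  \<comment> \<open>The only use of D R D <= I: it serves for \<sigma> in the diagonal sum and for
    \<open>R\<close> in the total.\<close>
  have mono1: "Re (mat_trace (X * (D * (R * D)))) \<le> Re (mat_trace X)" if "psd d X" for X
  proof -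
    have "mat_trace (X * (D * R * D)) \<le> mat_trace (X * 1\<^sub>m d)"
      using Dc Rc by (intro psd_trace_mult_mono[OF that DRD]) auto
    then show ?thesis using Dc Rc psd_carrier[OF that]
      by (simp add: less_eq_complex_def assoc_mult_mat[of _ d d _ d _ d])
  qed
  have g0: "0 \<le> g z w" if "z \<in> ?C" "w \<in> ?C" for z w
    using psd_trace_mult_nonneg[of d "\<rho> z" "D * (\<rho> w * D)"] sandwich \<rho> that
    by (simp add: g_def less_eq_complex_def)
  have diag: "(\<Sum>z\<in>?C. g z z) \<le> Re (mat_trace \<sigma>)"
  proof -
    \<comment> \<open>Replacing one of the two factors rho^z by \<sigma> leaves an expression linear
      in rho^z, whose sum over \<open>z\<close> collapses to \<open>R\<close>.\<close>
    have "g z z \<le> Re (mat_trace (\<rho> z * (D * (\<sigma> * D))))" if z: "z \<in> ?C" for z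
    proof -
      let ?M = "D * (\<rho> z * D)"
      have M: "psd d ?M" using sandwich \<rho> z by blast
      have "mat_trace (?M * \<rho> z) \<le> mat_trace (?M * \<sigma>)"
        using \<sigma> z by (intro psd_trace_mult_mono[OF M _ \<rho>c[OF z] \<sigma>c]) auto
      also have "mat_trace (?M * \<sigma>) = mat_trace (\<sigma> * ?M)"
        by (rule mat_trace_comm[OF psd_carrier[OF M] \<sigma>c])
      also have "\<dots> = mat_trace (\<rho> z * (D * (\<sigma> * D)))"
        by (rule trace_sandwich_swap[OF \<sigma>c \<rho>c[OF z] Dc])
      also have "mat_trace (?M * \<rho> z) = mat_trace (\<rho> z * ?M)"
        by (rule mat_trace_comm[OF psd_carrier[OF M] \<rho>c[OF z]])
      finally show ?thesis by (simp add: g_def less_eq_complex_def)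
    qed
    then have "(\<Sum>z\<in>?C. g z z) \<le> (\<Sum>z\<in>?C. Re (mat_trace (\<rho> z * (D * (\<sigma> * D)))))"
      by (rule sum_mono)
    also have "\<dots> = Re (mat_trace (R * (D * (\<sigma> * D))))"
      unfolding R_def using \<rho>c Dc \<sigma>c by (subst mat_sum_trace_mult) auto
    also have "\<dots> = Re (mat_trace (\<sigma> * (D * (R * D))))"
      by (simp only: trace_sandwich_swap[OF Rc \<sigma>c Dc])
    also have "\<dots> \<le> Re (mat_trace \<sigma>)" by (rule mono1[OF \<sigma>(1)])
    finally show ?thesis .
  qed
  have total: "(\<Sum>z\<in>?C. \<Sum>w\<in>?C. g z w) \<le> t"
  proof -
    have "(\<Sum>z\<in>?C. \<Sum>w\<in>?C. g z w) = Re (mat_trace (R * D * (R * D)))"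
      unfolding R_def g_def using \<rho>c Dc by (subst collision_mat_sum) auto
    also have "\<dots> = Re (mat_trace (R * (D * (R * D))))"
      using Rc Dc by (simp add: assoc_mult_mat[of _ d d _ d _ d])
    also have "\<dots> \<le> t" using mono1[OF R] trR by simp
    finally show ?thesis .
  qed
  define c where "c f = 2 ^ m * (\<Sum>z\<in>?C. \<Sum>w\<in>?C. of_bool (f z = f w) * g z w)" for f :: "bit vec \<Rightarrow> bit vec"
  define V where "V f = exp2 (H_max m d (cq_op m d (hashed n d f \<rho>)) - ereal (real m))" for f
  have V: "t / b * (2 * t - c f) \<le> V f" if f: "f \<in> set_pmf F" for f
  proof (rule linear_lower_bound_of_cubic[OF t(2) b])
    show "0 \<le> V f" by (simp add: V_def exp2_nonneg)
    have im: "f ` ?C \<subseteq> carrier_vec m"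
      using F f by (auto simp: linear_random_function_def f2_linear_def)
    have h: "\<forall>k \<in> carrier_vec m. psd d (hashed n d f \<rho> k)"
      unfolding hashed_def using \<rho> by (intro ballI psd_mat_sum) auto
    have "(\<Sum>k\<in>carrier_vec m. Re (mat_trace (hashed n d f \<rho> k)))
        = (\<Sum>k\<in>carrier_vec m. \<Sum>z\<in>{z \<in> ?C. f z = k}. Re (mat_trace (\<rho> z)))"
      unfolding hashed_def by (intro sum.cong refl, subst mat_sum_trace) (auto intro: \<rho>c)
    also have "\<dots> = (\<Sum>z\<in>?C. Re (mat_trace (\<rho> z)))"
      by (rule sum.group) (use im in auto)
    also have "\<dots> = t" unfolding t(1) using \<rho>c by (simp add: trace_cq_op[OF d])
    finally have th: "(\<Sum>k\<in>carrier_vec m. Re (mat_trace (hashed n d f \<rho> k))) = t" .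
    have "(\<Sum>k\<in>carrier_vec m. Re (mat_trace (hashed n d f \<rho> k * D * (hashed n d f \<rho> k * D))))
        = (\<Sum>k\<in>carrier_vec m. \<Sum>z\<in>{z \<in> ?C. f z = k}. \<Sum>w\<in>{z \<in> ?C. f z = k}. g z w)"
      unfolding hashed_def g_def by (rule sum.cong[OF refl], subst collision_mat_sum) (auto intro: \<rho>c Dc)
    also have "\<dots> = (\<Sum>z\<in>?C. \<Sum>w\<in>?C. of_bool (f z = f w) * g z w)"
      by (rule sum_fibres) (use im in auto)
    finally have "2 ^ m * (\<Sum>k\<in>carrier_vec m. Re (mat_trace (hashed n d f \<rho> k * D * (hashed n d f \<rho> k * D)))) = c f"
      by (simp add: c_def)
    then show "t ^ 3 \<le> V f * (b * c f)"
      using trace_cubed_le_exp2_H_max_collision[OF d h S D SD trSS b]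
      unfolding th V_def by (simp add: mult.assoc)
  qed
  have K: "(\<Sum>f\<in>set_pmf F. pmf F f * c f) \<le> 2 ^ m * Re (mat_trace \<sigma>) + \<delta> * t"
    unfolding c_def by (rule expected_collision_bound[OF F u n g0 diag total])
  have p1: "(\<Sum>f\<in>set_pmf F. pmf F f) = 1" by (rule sum_pmf_eq_1[OF fin order_refl])
  have "measure_pmf.expectation F (\<lambda>f. Q_PA n m d f \<rho>) = (\<Sum>f\<in>set_pmf F. pmf F f * (t - V f))"
    unfolding expectation_finite_pmf[OF fin] by (simp add: Q_PA_def V_def t(1))
  also have "\<dots> \<le> (\<Sum>f\<in>set_pmf F. pmf F f * (t - t / b * (2 * t - c f)))"
    by (intro sum_mono mult_left_mono) (use V in auto)
  also have "\<dots> = (\<Sum>f\<in>set_pmf F. pmf F f * (t - t / b * (2 * t)) + t / b * (pmf F f * c f))"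
    by (intro sum.cong refl) (simp only: right_diff_distrib, simp add: ac_simps)
  also have "\<dots> = (t - t / b * (2 * t)) + t / b * (\<Sum>f\<in>set_pmf F. pmf F f * c f)"
    unfolding sum.distrib sum_distrib_right[symmetric] sum_distrib_left[symmetric] p1 by simp
  also have "\<dots> \<le> (t - t / b * (2 * t)) + t / b * (2 ^ m * Re (mat_trace \<sigma>) + \<delta> * t)"
    using K t(2) b by (intro add_left_mono mult_left_mono) auto
  also have "\<dots> = t - t / b * (2 * t - (2 ^ m * Re (mat_trace \<sigma>) + \<delta> * t))"
    unfolding right_diff_distrib[of "t / b"] by linarith
  finally show ?thesis unfolding b_def .
qed

theorem lemma6:
  fixes n m d :: nat
    and \<delta> :: real
    and F :: "(bit vec \<Rightarrow> bit vec) pmf"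
    and \<rho> :: "bit vec \<Rightarrow> complex mat"
  assumes "n \<ge> 1"
    and "linear_random_function n m F"
    and "almost_universal2 n m \<delta> F"
    and "\<forall>z \<in> carrier_vec n. \<rho> z \<in> carrier_mat d d"
    and "subnormalized_state (2 ^ n * d) (cq_op n d \<rho>)"
  shows "measure_pmf.expectation F (\<lambda>f. Q_PA n m d f \<rho>)
    \<le> (\<delta> - 1) * Re (mat_trace (cq_op n d \<rho>))
      + exp2 (ereal (real m) - H_min n d (cq_op n d \<rho>))"
proof -
  let ?C = "carrier_vec n :: bit vec set"
  define t where "t = Re (mat_trace (cq_op n d \<rho>))"
  let ?E = "measure_pmf.expectation F (\<lambda>f. Q_PA n m d f \<rho>)"
  have fin: "finite (set_pmf F)" using assms(2) by (simp add: linear_random_function_def)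
  have cq: "psd (2 ^ n * d) (cq_op n d \<rho>)" using assms(5) by (simp add: subnormalized_state_def)
  have t0: "0 \<le> t" using psd_trace_nonneg[OF cq] by (simp add: t_def less_eq_complex_def)
  have "?E - (\<delta> - 1) * t \<le> exp2 (ereal (real m) - H_min n d (cq_op n d \<rho>))"
  proof (cases "t = 0")
    \<comment> \<open>The main argument divides by \<open>t\<close>. For trace 0 every index is
      minus a value of \<open>exp2\<close>, hence nonpositive.\<close>
    case True
    have "?E = (\<Sum>f\<in>set_pmf F. pmf F f * Q_PA n m d f \<rho>)"
      by (rule expectation_finite_pmf[OF fin])
    also have "\<dots> \<le> 0"
      using True exp2_nonneg unfolding Q_PA_def t_def[symmetric]
      by (intro sum_nonpos mult_nonneg_nonpos) auto
    finally show ?thesis using True exp2_nonneg[of "ereal (real m) - H_min n d (cq_op n d \<rho>)"] by simp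
  next
    case False
    then have tpos: "t > 0" using t0 by simp
    \<comment> \<open>In dimension 0 every trace is an empty sum, which \<open>t > 0\<close> rules
      out.\<close>
    have d: "d > 0"
    proof (rule ccontr)
      assume "\<not> d > 0"
      then have "t = 0" by (simp add: t_def mat_trace_def cq_op_def mat_sum_def)
      then show False using False by simp
    qed
    note cqb = cq_op_eq_bdiag[OF d assms(4)]
    have bc: "\<rho> (index_bits n k) \<in> carrier_mat d d" if "k < 2 ^ n" for k
      using assms(4) index_bits_carrier[OF that] by blast
    \<comment> \<open>Positivity is assumed of the whole operator only; each rho^z inherits it as a
      diagonal block.\<close>
    have \<rho>: "\<forall>z \<in> ?C. psd d (\<rho> z)"
    proof
      fix z :: "bit vec" assume "z \<in> ?C"
      then obtain k where "k < 2 ^ n" "index_bits n k = z" using index_bits_surj by blast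
      then show "psd d (\<rho> z)"
        using psd_bdiag_block[OF d bc cq[unfolded cqb], of k] by auto
    qed
    define Feas where "Feas = {\<sigma>. psd d \<sigma> \<and> loewner_le (2 ^ n * d) (cq_op n d \<rho>) (kron (1\<^sub>m (2 ^ n)) \<sigma>)}"
    have diff: "kron (1\<^sub>m (2 ^ n)) \<sigma> - cq_op n d \<rho> = bdiag (2 ^ n) d (\<lambda>k. \<sigma> - \<rho> (index_bits n k))"
      if "\<sigma> \<in> carrier_mat d d" for \<sigma>
    proof -
      have one: "(1 :: complex) \<cdot>\<^sub>m X = X" for X by (intro eq_matI) auto
      have "kron (1\<^sub>m (2 ^ n)) \<sigma> = bdiag (2 ^ n) d (\<lambda>_. \<sigma>)"
        using kron_scaled_one[OF that, of 1 "2 ^ n"] unfolding one .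
      then show ?thesis unfolding cqb using that bc by (simp add: bdiag_diff[OF d])
    qed
    \<comment> \<open>The witness rho_E shows that the infimum in \<open>H_min\<close> ranges over a
      nonempty set.\<close>
    have "mat_sum d \<rho> ?C \<in> Feas"
    proof -
      have "psd d (mat_sum d \<rho> ?C - \<rho> (index_bits n k))" if "k < 2 ^ n" for k
        using \<rho> index_bits_carrier[OF that] by (intro psd_mat_sum_diff) auto
      then show ?thesis
        unfolding Feas_def loewner_le_def mem_Collect_eq diff[OF mat_sum_carrier]
        using \<rho> by (intro conjI psd_mat_sum psd_bdiag[OF d]) auto
    qed
    then show ?thesis unfolding Feas_def
    proof (rule two_power_Inf_le_exp2_H_min, fold Feas_def)
      fix \<sigma> assume "\<sigma> \<in> Feas"
      then have \<sigma>: "psd d \<sigma>" and le: "psd (2 ^ n * d) (kron (1\<^sub>m (2 ^ n)) \<sigma> - cq_op n d \<rho>)"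
        by (auto simp: Feas_def loewner_le_def)
      have \<sigma>c: "\<sigma> \<in> carrier_mat d d" using \<sigma> by (rule psd_carrier)
      have \<sigma>\<rho>: "\<forall>z \<in> ?C. psd d (\<sigma> - \<rho> z)"
      proof
        fix z :: "bit vec" assume "z \<in> ?C"
        then obtain k where k: "k < 2 ^ n" "index_bits n k = z" using index_bits_surj by blast
        have "psd d (\<sigma> - \<rho> (index_bits n k))"
          by (rule psd_bdiag_block[OF d _ le[unfolded diff[OF \<sigma>c]] k(1)])
            (use bc \<sigma>c in \<open>auto intro!: minus_carrier_mat\<close>)
        then show "psd d (\<sigma> - \<rho> z)" using k(2) by simp
      qed
      define K where "K = 2 ^ m * Re (mat_trace \<sigma>) + \<delta> * t"
      \<comment> \<open>Since \<open>t > 0\<close>, the bound is continuous at \<open>e = 0\<close>,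
        where the fraction is 1 and the value is \<open>K - t\<close>.\<close>
      have "((\<lambda>e. t - t / (t + e * real d) * (2 * t - K)) \<longlongrightarrow> t - t / (t + 0 * real d) * (2 * t - K)) (at_right 0)"
        using tpos by (intro tendsto_intros) auto
      moreover have "\<forall>\<^sub>F e in at_right 0. ?E \<le> t - t / (t + e * real d) * (2 * t - K)"
        using eventually_at_right_less[of 0]
      proof eventually_elim
        case (elim e)
        show ?case unfolding K_def
          by (rule expected_Q_PA_bound[OF assms(1-3) d \<rho> \<sigma> \<sigma>\<rho> t_def tpos elim])
      qed
      ultimately have "?E \<le> t - t / (t + 0 * real d) * (2 * t - K)"
        by (rule tendsto_lowerbound) simp
      then have "?E \<le> K - t" using tpos by simp
      then show "?E - (\<delta> - 1) * t \<le> 2 ^ m * Re (mat_trace \<sigma>)"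
        by (simp add: K_def algebra_simps)
    qed
  qed
  then show ?thesis unfolding t_def by simp
qed

end
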